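(* Let $V$ and $W$ be analytic discs attached to the unit sphere, with embedding maps $f$ and $g$ respectively. If $\mathcal{M}_f = \mathcal{M}_g$ (as sets of functions on $\mathbb{D}$), then for all $\xi, \zeta \in \mathbb{T}$, $$f(\xi) = f(\zeta) \iff g(\xi) = g(\zeta).$$
   Context: Notation: $\mathbb{D}$ is the open unit disc, $\mathbb{T}$ the unit circle, $\mathbb{B}_d$ the open Euclidean unit ball of $\mathbb{C}^d$, with $\langle z,w\rangle=\sum_j z_j\overline{w_j}$. The Drury-Arveson space $H^2_d$ is the reproducing kernel Hilbert space (RKHS) on $\mathbb{B}_d$ with kernel $\kappa_w(z)=\frac{1}{1-\langle z,w\rangle}$; $\mathcal{M}_d=\operatorname{Mult}(H^2_d)$ is its multiplier algebra. A variety in $\mathbb{B}_d$ is a set of the form $\{z\in\mathbb{B}_d:\varphi(z)=0\ \text{for all}\ \varphi\in E\}$ with $E\subset\mathcal{M}_d$. An analytic disc attached to the unit sphere is a variety $V\subset\mathbb{B}_d$, $d<\infty$, for which there exists an injective analytic map $f:\mathbb{D}\to\mathbb{B}_d$ with $f'(z)\neq 0$ for $z\in\mathbb{D}$, such that $V=f(\mathbb{D})$, $f$ extends to be $C^2$ up to $\overline{\mathbb{D}}$, and for $x\in\overline{\mathbb{D}}$, $\|f(x)\|=1\iff|x|=1$. Such an $f$ is called an embedding map of $V$; the same letter denotes its extension to $\overline{\mathbb{D}}$. For a variety $V$, $\mathcal{H}_V$ is the closed linear span of $\{\kappa_\lambda:\lambda\in V\}$ in $H^2_d$, regarded as an RKHS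 of functions on $V$, and $\mathcal{M}_V=\{\varphi|_V:\varphi\in\mathcal{M}_d\}$, which equals $\operatorname{Mult}(\mathcal{H}_V)$ and carries the multiplier norm. If $f$ is an embedding map of $V$, then $\mathcal{M}_f=\{\varphi:\mathbb{D}\to\mathbb{C}:\ \varphi\circ f^{-1}\in\mathcal{M}_V\}$ with $\|\varphi\|_{\mathcal{M}_f}=\|\varphi\circ f^{-1}\|_{\mathcal{M}_V}$. *)

theory Defs
  imports "HOL-Complex_Analysis.Complex_Analysis"
begin

(* A complex-valued function on a set X is encoded as a total function vanishing off X,
   so that pointwise equality of total functions is equality of functions on X. *)
definition zero_ext :: "'a set \<Rightarrow> ('a \<Rightarrow> complex) \<Rightarrow> 'a \<Rightarrow> complex" where
  "zero_ext X h = (\<lambda>x. if x \<in> X then h x else 0)"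

definition fun_on :: "'a set \<Rightarrow> ('a \<Rightarrow> complex) set" where
  "fun_on X = {h. \<forall>x. x \<notin> X \<longrightarrow> h x = 0}"

(* H with the inner product ip (linear in the first argument) is a Hilbert space of functions
   on X with reproducing kernel k, where k z w is the value at z of the kernel function at w.
   Nothing is required of ip outside H. *)
locale is_rkhs =
  fixes X :: "'a set"
    and k :: "'a \<Rightarrow> 'a \<Rightarrow> complex"
    and H :: "('a \<Rightarrow> complex) set"
    and ip :: "('a \<Rightarrow> complex) \<Rightarrow> ('a \<Rightarrow> complex) \<Rightarrow> complex"
  assumes subset_fun_on: "H \<subseteq> fun_on X"
    and zero_mem: "(\<lambda>x. 0) \<in> H"
    and add_mem: "\<And>h h'. h \<in> H \<Longrightarrow> h' \<in> H \<Longrightarrow> (\<lambda>x. h x + h' x) \<in> H"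
    and scale_mem: "\<And>c h. h \<in> H \<Longrightarrow> (\<lambda>x. c * h x) \<in> H"
    and ip_add: "\<And>h h' u. h \<in> H \<Longrightarrow> h' \<in> H \<Longrightarrow> u \<in> H \<Longrightarrow>
                   ip (\<lambda>x. h x + h' x) u = ip h u + ip h' u"
    and ip_scale: "\<And>c h u. h \<in> H \<Longrightarrow> u \<in> H \<Longrightarrow> ip (\<lambda>x. c * h x) u = c * ip h u"
    and ip_cnj: "\<And>h u. h \<in> H \<Longrightarrow> u \<in> H \<Longrightarrow> ip u h = cnj (ip h u)"
    and ip_nonneg: "\<And>h. h \<in> H \<Longrightarrow> 0 \<le> Re (ip h h)"
    and ip_definite: "\<And>h. h \<in> H \<Longrightarrow> ip h h = 0 \<Longrightarrow> h = (\<lambda>x. 0)"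
    and ip_complete: "\<And>s :: nat \<Rightarrow> 'a \<Rightarrow> complex.
          (\<And>n. s n \<in> H) \<Longrightarrow>
          (\<forall>e>0. \<exists>N. \<forall>m\<ge>N. \<forall>n\<ge>N.
             sqrt (Re (ip (\<lambda>x. s m x - s n x) (\<lambda>x. s m x - s n x))) < e) \<Longrightarrow>
          \<exists>h\<in>H. (\<lambda>n. sqrt (Re (ip (\<lambda>x. s n x - h x) (\<lambda>x. s n x - h x)))) \<longlonglongrightarrow> 0"
    and kernel_mem: "\<And>w. w \<in> X \<Longrightarrow> zero_ext X (\<lambda>z. k z w) \<in> H"
    and reproducing: "\<And>h w. h \<in> H \<Longrightarrow> w \<in> X \<Longrightarrow> h w = ip h (zero_ext X (\<lambda>z. k z w))"

(* By the Moore-Aronszajn theorem, H exists and is unique when k is positive definite. *)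
definition rkhs :: "'a set \<Rightarrow> ('a \<Rightarrow> 'a \<Rightarrow> complex) \<Rightarrow> ('a \<Rightarrow> complex) set" where
  "rkhs X k = (THE H. \<exists>ip. is_rkhs X k H ip)"

definition Mult :: "'a set \<Rightarrow> ('a \<Rightarrow> complex) set \<Rightarrow> ('a \<Rightarrow> complex) set" where
  "Mult X H = {\<phi> \<in> fun_on X. \<forall>h\<in>H. (\<lambda>x. \<phi> x * h x) \<in> H}"

(* The class inner product on complex ^ 'd is only the real part of this one; the norm is
   the Euclidean norm induced by either. *)
definition cinner :: "complex ^ 'd \<Rightarrow> complex ^ 'd \<Rightarrow> complex" where
  "cinner z w = (\<Sum>j\<in>UNIV. z $ j * cnj (w $ j))"

definition drury_arveson :: "(complex ^ 'd \<Rightarrow> complex) set" where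
  "drury_arveson = rkhs (ball 0 1) (\<lambda>z w. 1 / (1 - cinner z w))"

definition DA_mult :: "(complex ^ 'd \<Rightarrow> complex) set" where
  "DA_mult = Mult (ball 0 1) drury_arveson"

definition variety :: "(complex ^ 'd) set \<Rightarrow> bool" where
  "variety V \<longleftrightarrow> (\<exists>E \<subseteq> DA_mult. V = {z \<in> ball 0 1. \<forall>\<phi>\<in>E. \<phi> z = 0})"

(* Real derivatives, taken within S: for the closed disc this is "C^2 up to the boundary". *)
definition C2_on :: "'a::real_normed_vector set \<Rightarrow> ('a \<Rightarrow> 'b::real_normed_vector) \<Rightarrow> bool" where
  "C2_on S f \<longleftrightarrow>
     (\<exists>(f' :: 'a \<Rightarrow> 'a \<Rightarrow>\<^sub>L 'b) (f'' :: 'a \<Rightarrow> 'a \<Rightarrow>\<^sub>L 'a \<Rightarrow>\<^sub>L 'b).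
        (\<forall>x\<in>S. (f has_derivative blinfun_apply (f' x)) (at x within S)) \<and>
        (\<forall>x\<in>S. (f' has_derivative blinfun_apply (f'' x)) (at x within S)) \<and>
        continuous_on S f'')"

(* f stands for the extension to the closed disc; its values elsewhere are irrelevant. *)
definition disc_embedding :: "(complex ^ 'd) set \<Rightarrow> (complex \<Rightarrow> complex ^ 'd) \<Rightarrow> bool" where
  "disc_embedding V f \<longleftrightarrow>
     f ` ball 0 1 \<subseteq> ball 0 1 \<and>
     (\<forall>j. (\<lambda>z. f z $ j) holomorphic_on ball 0 1) \<and>
     inj_on f (ball 0 1) \<and>
     (\<forall>z \<in> ball 0 1. (\<chi> j. deriv (\<lambda>w. f w $ j) z) \<noteq> 0) \<and>
     V = f ` ball 0 1 \<and>
     C2_on (cball 0 1) f \<and>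
     (\<forall>x \<in> cball 0 1. norm (f x) = 1 \<longleftrightarrow> norm x = 1)"

definition attached_analytic_disc :: "(complex ^ 'd) set \<Rightarrow> bool" where
  "attached_analytic_disc V \<longleftrightarrow> variety V \<and> (\<exists>f. disc_embedding V f)"

definition variety_mult :: "(complex ^ 'd) set \<Rightarrow> (complex ^ 'd \<Rightarrow> complex) set" where
  "variety_mult V = zero_ext V ` DA_mult"

definition disc_mult ::
    "(complex ^ 'd) set \<Rightarrow> (complex \<Rightarrow> complex ^ 'd) \<Rightarrow> (complex \<Rightarrow> complex) set" where
  "disc_mult V f =
     {\<phi> \<in> fun_on (ball 0 1). zero_ext V (\<phi> \<circ> the_inv_into (ball 0 1) f) \<in> variety_mult V}"

end

theory Submission
  imports Defs
begin

text \<open>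
  Suppose that \<open>f \<xi> = f \<zeta> = p\<close>. The coordinates of the ball are multipliers of the Drury-Arveson
  space, so each coordinate of \<open>g\<close> belongs to the algebra of \<open>g\<close>, hence to that of \<open>f\<close>: it has the
  form \<open>\<Phi> \<circ> f\<close> with a Drury-Arveson multiplier \<open>\<Phi>\<close> (\<open>coordinate_factors_through\<close>). It is
  therefore enough to find points \<open>z \<rightarrow> \<xi>\<close> and \<open>w \<rightarrow> \<zeta>\<close> of the disc whose images \<open>f z\<close>, \<open>f w\<close> no
  multiplier can tell apart in the limit; then \<open>g \<xi> = g \<zeta>\<close> by continuity. The converse
  implication is the same with \<open>f\<close> and \<open>g\<close> exchanged.

  How far a multiplier can separate two points is controlled by the kernel \<open>k\<close>: since
  multiplication by \<open>\<Phi>\<close> is bounded, testing it on the kernel function at \<open>z\<close> gives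
    \<open>|\<Phi> z - \<Phi> w|^2 \<le> C (k z z k w w / |k z w|^2 - 1)\<close>
  (\<open>multiplier_oscillation\<close>). For the Drury-Arveson kernel the first term on the right is
  \<open>|1 - \<langle>z,w\<rangle>|^2 / ((1 - |z|^2) (1 - |w|^2))\<close>.

  The points are chosen on the radii at \<open>\<xi>\<close> and \<open>\<zeta>\<close>, with speeds that balance the normal derivatives
  of \<open>f\<close>. The function \<open>\<langle>f, p\<rangle>\<close> maps the disc into itself and attains the value 1 at \<open>\<xi>\<close>, so its
  radial derivative \<open>A\<close> at \<open>\<xi>\<close> is real, because \<open>|\<langle>f, p\<rangle>|\<close> is maximal there on the circle, and
  positive, by the Hopf boundary lemma; likewise \<open>B > 0\<close> at \<open>\<zeta>\<close>
  (\<open>disc_embedding_normal_derivative\<close>). With \<open>z = (1 - t/A) \<xi>\<close> and \<open>w = (1 - t/B) \<zeta>\<close> each of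
  \<open>1 - |f z|^2\<close>, \<open>1 - |f w|^2\<close> and \<open>1 - \<langle>f z, f w\<rangle>\<close> is \<open>2 t + o(t)\<close>, so the ratio above tends to 1
  (\<open>kernel_ratio_limit\<close>).

  The Drury-Arveson space is specified as the unique space of functions on the ball with the given
  reproducing kernel, so its existence and uniqueness are proved as well, for any positive
  semidefinite kernel (the Moore-Aronszajn theorem, \<open>rkhs_eq_native_space\<close>). The square of the norm
  is introduced as the supremum of \<open>2 Re \<langle>h, u\<rangle> - |u|^2\<close> over finite combinations \<open>u\<close> of kernel
  functions. This makes sense for every function \<open>h\<close>, turns completeness and lower semicontinuity
  into statements about pointwise limits, and gives the parallelogram law by a substitution; the
  inner product follows by polarization.
\<close>

unbundle no fps_syntax

section \<open>Formal combinations of kernel functions\<close>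

text \<open>
  A list \<open>[(c1, x1), ..., (cn, xn)]\<close> stands for the combination of the kernel functions at the
  points \<open>xi\<close> with coefficients \<open>ci\<close>. Lists are used, instead of the functions that they represent,
  because different lists may represent the same function: addition is concatenation, and nothing has
  to be shown independent of the representation. In a space with reproducing kernel \<open>k\<close>, \<open>pairing h cs\<close>
  is the inner product of \<open>h\<close> with \<open>comb k cs\<close>, and \<open>sq_norm k cs\<close> is the squared norm of
  \<open>comb k cs\<close>.
\<close>
definition pairing :: "('a \<Rightarrow> complex) \<Rightarrow> (complex \<times> 'a) list \<Rightarrow> complex" where
  "pairing h cs = (\<Sum>(c, x)\<leftarrow>cs. cnj c * h x)"

definition comb :: "('a \<Rightarrow> 'a \<Rightarrow> complex) \<Rightarrow> (complex \<times> 'a) list \<Rightarrow> 'a \<Rightarrow> complex" where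
  "comb k cs y = (\<Sum>(c, x)\<leftarrow>cs. c * k y x)"

definition sq_norm :: "('a \<Rightarrow> 'a \<Rightarrow> complex) \<Rightarrow> (complex \<times> 'a) list \<Rightarrow> real" where
  "sq_norm k cs = Re (pairing (comb k cs) cs)"

definition scale_combo :: "complex \<Rightarrow> (complex \<times> 'a) list \<Rightarrow> (complex \<times> 'a) list" where
  "scale_combo t cs = map (\<lambda>(c, x). (t * c, x)) cs"

definition combos :: "'a set \<Rightarrow> (complex \<times> 'a) list set" where
  "combos X = {cs. snd ` set cs \<subseteq> X}"

lemma pairing_simps [simp]:
  "pairing h [] = 0"
  "pairing h ((c, x) # cs) = cnj c * h x + pairing h cs"
  "pairing h (cs @ ds) = pairing h cs + pairing h ds"
  by (simp_all add: pairing_def)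

lemma pairing_scale_combo [simp]: "pairing h (scale_combo t cs) = cnj t * pairing h cs"
  by (induction cs) (auto simp: scale_combo_def algebra_simps)

lemma pairing_fun_add: "pairing (\<lambda>x. h x + u x) cs = pairing h cs + pairing u cs"
  by (induction cs) (auto simp: algebra_simps)

lemma pairing_fun_diff: "pairing (\<lambda>x. h x - u x) cs = pairing h cs - pairing u cs"
  by (induction cs) (auto simp: algebra_simps)

lemma pairing_fun_scale: "pairing (\<lambda>x. a * h x) cs = a * pairing h cs"
  by (induction cs) (auto simp: algebra_simps)

lemma pairing_zero [simp]: "pairing (\<lambda>x. 0) cs = 0"
  by (induction cs) auto

lemma comb_simps [simp]:
  "comb k [] = (\<lambda>y. 0)"
  "comb k ((c, x) # cs) = (\<lambda>y. c * k y x + comb k cs y)"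
  "comb k (cs @ ds) = (\<lambda>y. comb k cs y + comb k ds y)"
  by (auto simp: comb_def)

lemma comb_scale_combo [simp]: "comb k (scale_combo t cs) = (\<lambda>y. t * comb k cs y)"
  by (induction cs) (auto simp: scale_combo_def algebra_simps)

lemma combos_simps [simp]:
  "[] \<in> combos X"
  "(c, x) # cs \<in> combos X \<longleftrightarrow> x \<in> X \<and> cs \<in> combos X"
  "cs @ ds \<in> combos X \<longleftrightarrow> cs \<in> combos X \<and> ds \<in> combos X"
  "scale_combo t cs \<in> combos X \<longleftrightarrow> cs \<in> combos X"
  by (auto simp: combos_def scale_combo_def case_prod_unfold image_image)

lemma pairing_zero_ext [simp]: "cs \<in> combos X \<Longrightarrow> pairing (zero_ext X h) cs = pairing h cs"
  by (induction cs) (auto simp: zero_ext_def)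

lemma pairing_tendsto:
  assumes "\<And>x. x \<in> X \<Longrightarrow> (\<lambda>n. s n x) \<longlonglongrightarrow> h x" "cs \<in> combos X"
  shows "(\<lambda>n. pairing (s n) cs) \<longlonglongrightarrow> pairing h cs"
  using assms(2) by (induction cs) (auto intro!: tendsto_intros assms(1))

lemma sq_norm_scale_combo: "sq_norm k (scale_combo t cs) = (cmod t)\<^sup>2 * sq_norm k cs"
proof -
  have "pairing (comb k (scale_combo t cs)) (scale_combo t cs) = (t * cnj t) * pairing (comb k cs) cs"
    by (simp add: pairing_fun_scale)
  also have "t * cnj t = of_real ((cmod t)\<^sup>2)"
    by (rule complex_norm_square[symmetric])
  finally show ?thesis by (simp add: sq_norm_def del: of_real_power)
qed

section \<open>The space of a positive semidefinite kernel\<close>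

locale psd_kernel =
  fixes X :: "'a set" and k :: "'a \<Rightarrow> 'a \<Rightarrow> complex"
  assumes herm: "\<And>x y. x \<in> X \<Longrightarrow> y \<in> X \<Longrightarrow> k y x = cnj (k x y)"
    and psd: "\<And>cs. cs \<in> combos X \<Longrightarrow> 0 \<le> sq_norm k cs"
begin

text \<open>
  In a Hilbert space, \<open>2 Re \<langle>h, u\<rangle> - |u|^2 = |h|^2 - |h - u|^2\<close>, so its supremum over a dense set of
  vectors \<open>u\<close> is \<open>|h|^2\<close>. Here \<open>u\<close> runs over the combinations of kernel functions, for which both
  terms can be written down before there is any Hilbert space.
\<close>
definition energy :: "('a \<Rightarrow> complex) \<Rightarrow> (complex \<times> 'a) list \<Rightarrow> real" where
  "energy h cs = 2 * Re (pairing h cs) - sq_norm k cs"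

definition native_space :: "('a \<Rightarrow> complex) set" where
  "native_space = {h \<in> fun_on X. bdd_above (energy h ` combos X)}"

definition norm_sq :: "('a \<Rightarrow> complex) \<Rightarrow> real" where
  "norm_sq h = (SUP cs\<in>combos X. energy h cs)"

lemma pairing_comb_sym:
  assumes "cs \<in> combos X" "ds \<in> combos X"
  shows "pairing (comb k ds) cs = cnj (pairing (comb k cs) ds)"
  using assms
proof (induction cs)
  case (Cons p cs)
  obtain c x where p: "p = (c, x)" by force
  have "comb k ds x = cnj (pairing (\<lambda>y. k y x) ds)" if "x \<in> X"
    using Cons.prems(2) that by (induction ds) (auto simp: herm[of _ x])
  then show ?case using Cons by (simp add: p pairing_fun_add pairing_fun_scale)
qed simp

lemma sq_norm_append:
  assumes "cs \<in> combos X" "ds \<in> combos X"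
  shows "sq_norm k (cs @ ds) = sq_norm k cs + sq_norm k ds + 2 * Re (pairing (comb k cs) ds)"
  using pairing_comb_sym[OF assms]
  by (simp add: sq_norm_def pairing_fun_add)

lemma energy_le: "h \<in> native_space \<Longrightarrow> cs \<in> combos X \<Longrightarrow> energy h cs \<le> norm_sq h"
  by (auto simp: native_space_def norm_sq_def intro: cSUP_upper)

lemma norm_sq_le: "(\<And>cs. cs \<in> combos X \<Longrightarrow> energy h cs \<le> M) \<Longrightarrow> norm_sq h \<le> M"
  unfolding norm_sq_def by (rule cSUP_least) (auto intro: combos_simps)

lemma native_spaceI:
  "h \<in> fun_on X \<Longrightarrow> (\<And>cs. cs \<in> combos X \<Longrightarrow> energy h cs \<le> M) \<Longrightarrow> h \<in> native_space"
  by (auto simp: native_space_def intro!: bdd_aboveI2)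

lemma norm_sq_nonneg: "h \<in> native_space \<Longrightarrow> 0 \<le> norm_sq h"
  using energy_le[of h "[]"] by (simp add: energy_def sq_norm_def)

lemma native_space_off: "h \<in> native_space \<Longrightarrow> x \<notin> X \<Longrightarrow> h x = 0"
  by (auto simp: native_space_def fun_on_def)

text \<open>
  The Cauchy-Schwarz inequality. It follows from the bound on the energy along the multiples of
  \<open>cs\<close>: after a choice of phase this is a real quadratic polynomial in the scaling factor.
\<close>
lemma pairing_bound:
  assumes h: "h \<in> native_space" and cs: "cs \<in> combos X"
  shows "(cmod (pairing h cs))\<^sup>2 \<le> norm_sq h * sq_norm k cs"
proof -
  define a where "a = pairing h cs"
  define \<alpha> where "\<alpha> = cmod a"
  have key: "2 * s * \<alpha> - s\<^sup>2 * sq_norm k cs \<le> norm_sq h" for s :: real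
  proof (cases "a = 0")
    case True
    then show ?thesis using norm_sq_nonneg[OF h] psd[OF cs] by (simp add: \<alpha>_def order_trans[of _ 0])
  next
    case False
    (* the phase makes the pairing of h with the scaled combination equal to s * \<alpha> *)
    define t where "t = of_real s * (a / of_real \<alpha>)"
    have \<alpha>: "\<alpha> > 0" using False by (simp add: \<alpha>_def)
    have "cmod t = \<bar>s\<bar>" using \<alpha> by (simp add: t_def norm_mult norm_divide \<alpha>_def)
    moreover have "cnj t * a = of_real (s * \<alpha>)"
    proof -
      have "cnj a * a = of_real (\<alpha>\<^sup>2)"
        unfolding \<alpha>_def by (metis complex_norm_square mult.commute)
      then have "cnj t * a = of_real s * of_real (\<alpha>\<^sup>2) / of_real \<alpha>"
        by (simp add: t_def)
      then show ?thesis using \<alpha> by (simp add: power2_eq_square)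
    qed
    ultimately have "energy h (scale_combo t cs) = 2 * (s * \<alpha>) - s\<^sup>2 * sq_norm k cs"
      by (simp add: energy_def sq_norm_scale_combo flip: a_def)
    then show ?thesis using energy_le[OF h, of "scale_combo t cs"] cs by simp
  qed
  have "\<alpha>\<^sup>2 \<le> norm_sq h * sq_norm k cs"
  proof (cases "sq_norm k cs = 0")
    case True
    have "\<alpha> = 0"
    proof (rule ccontr)
      assume "\<alpha> \<noteq> 0"
      (* the polynomial is linear with slope 2 * \<alpha>; at this s it exceeds norm_sq h *)
      then show False using key[of "(norm_sq h + 1) / (2 * \<alpha>)"] True by simp
    qed
    then show ?thesis using True by simp
  next
    case False
    then have "sq_norm k cs > 0" using psd[OF cs] by simp
    (* the maximum of the quadratic polynomial is attained here *)
    then show ?thesis using key[of "\<alpha> / sq_norm k cs"]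
      by (simp add: field_simps power2_eq_square)
  qed
  then show ?thesis by (simp add: \<alpha>_def a_def)
qed

lemma value_bound: "h \<in> native_space \<Longrightarrow> x \<in> X \<Longrightarrow> (cmod (h x))\<^sup>2 \<le> norm_sq h * Re (k x x)"
  using pairing_bound[of h "[(1, x)]"] by (simp add: sq_norm_def)

lemma norm_sq_leI:
  assumes M: "0 \<le> M" and le: "\<And>cs. cs \<in> combos X \<Longrightarrow> cmod (pairing h cs) \<le> M * sqrt (sq_norm k cs)"
  shows "norm_sq h \<le> M\<^sup>2"
proof (rule norm_sq_le)
  fix cs assume cs: "cs \<in> combos X"
  have "Re (pairing h cs) \<le> M * sqrt (sq_norm k cs)"
    using le[OF cs] complex_Re_le_cmod order_trans by blast
  moreover have "0 \<le> (M - sqrt (sq_norm k cs))\<^sup>2" by simp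
  ultimately show "energy h cs \<le> M\<^sup>2"
    using psd[OF cs] unfolding power2_diff energy_def by simp
qed

text \<open>
  The parallelogram law for the combinations \<open>(cs + ds) / 2\<close> and \<open>(cs - ds) / 2\<close>, rearranged: the
  left-hand side is twice the energy of \<open>h\<close> at the first plus twice the energy of \<open>u\<close> at the second.
\<close>
lemma energy_parallelogram:
  assumes h: "h \<in> native_space" and u: "u \<in> native_space" and cs: "cs \<in> combos X" and ds: "ds \<in> combos X"
  shows "energy (\<lambda>x. h x + u x) cs + energy (\<lambda>x. h x - u x) ds \<le> 2 * norm_sq h + 2 * norm_sq u"
proof -
  let ?p = "scale_combo (1/2) (cs @ ds)" and ?m = "scale_combo (1/2) (cs @ scale_combo (-1) ds)"
  have "energy (\<lambda>x. h x + u x) cs + energy (\<lambda>x. h x - u x) ds = 2 * energy h ?p + 2 * energy u ?m"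
    using cs ds
    by (simp add: energy_def pairing_fun_add pairing_fun_diff sq_norm_scale_combo sq_norm_append power2_eq_square
        norm_divide field_simps)
  moreover have "energy h ?p \<le> norm_sq h" "energy u ?m \<le> norm_sq u"
    using cs ds by (auto intro!: energy_le h u)
  ultimately show ?thesis by simp
qed

lemma native_space_zero: "(\<lambda>x. 0) \<in> native_space"
  by (rule native_spaceI[where M = 0])
    (auto simp: fun_on_def energy_def psd)

lemma native_space_add: "h \<in> native_space \<Longrightarrow> u \<in> native_space \<Longrightarrow> (\<lambda>x. h x + u x) \<in> native_space"
  using energy_parallelogram[of h u _ "[]"]
  by (intro native_spaceI[where M = "2 * norm_sq h + 2 * norm_sq u"])
    (auto simp: fun_on_def native_space_off energy_def sq_norm_def)

lemma energy_scale:
  assumes "a \<noteq> 0"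
  shows "energy (\<lambda>x. a * h x) cs = (cmod a)\<^sup>2 * energy h (scale_combo (1 / a) cs)"
proof -
  have "of_real ((cmod a)\<^sup>2) * cnj (1 / a) = a"
    using assms by (subst complex_norm_square) simp
  then have "a * z = of_real ((cmod a)\<^sup>2) * (cnj (1 / a) * z)" for z
    by (metis mult.assoc)
  then have "Re (a * z) = (cmod a)\<^sup>2 * Re (cnj (1 / a) * z)" for z
    by (metis Re_complex_of_real Im_complex_of_real complex.sel(1) times_complex.sel(1) mult_zero_left diff_zero)
  moreover have "(cmod a)\<^sup>2 * (cmod (1 / a))\<^sup>2 = 1"
    using assms by (simp add: norm_divide power_divide)
  ultimately show ?thesis
    by (simp only: energy_def pairing_scale_combo pairing_fun_scale sq_norm_scale_combo right_diff_distrib)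
      (simp add: mult.assoc[symmetric])
qed

lemma native_space_scale_le:
  assumes "h \<in> native_space"
  shows "(\<lambda>x. a * h x) \<in> native_space \<and> norm_sq (\<lambda>x. a * h x) \<le> (cmod a)\<^sup>2 * norm_sq h"
proof -
  have "energy (\<lambda>x. a * h x) cs \<le> (cmod a)\<^sup>2 * norm_sq h" if cs: "cs \<in> combos X" for cs
  proof (cases "a = 0")
    case True
    then show ?thesis
      using psd[OF cs] by (simp add: energy_def)
  next
    case False
    then show ?thesis using energy_le[OF assms, of "scale_combo (1/a) cs"] cs
      by (simp add: energy_scale mult_left_mono)
  qed
  then show ?thesis using assms
    by (auto intro!: native_spaceI[where M = "(cmod a)\<^sup>2 * norm_sq h"] norm_sq_le simp: fun_on_def native_space_off)
qed

lemma native_space_scale: "h \<in> native_space \<Longrightarrow> (\<lambda>x. a * h x) \<in> native_space"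
  using native_space_scale_le by blast

lemma native_space_diff: "h \<in> native_space \<Longrightarrow> u \<in> native_space \<Longrightarrow> (\<lambda>x. h x - u x) \<in> native_space"
  using native_space_add[OF _ native_space_scale[of u "-1"]] by simp

lemma norm_sq_scale:
  assumes "h \<in> native_space"
  shows "norm_sq (\<lambda>x. a * h x) = (cmod a)\<^sup>2 * norm_sq h"
proof (cases "a = 0")
  case True
  then show ?thesis using native_space_scale_le[OF assms, of 0] norm_sq_nonneg[OF native_space_zero] by simp
next
  case False
  have "norm_sq h = norm_sq (\<lambda>x. (1/a) * (a * h x))" using False by simp
  also have "\<dots> \<le> (cmod (1/a))\<^sup>2 * norm_sq (\<lambda>x. a * h x)"
    using native_space_scale_le native_space_scale[OF assms] by blast
  finally have "(cmod a)\<^sup>2 * norm_sq h \<le> norm_sq (\<lambda>x. a * h x)"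
    using False by (simp add: norm_divide field_simps)
  then show ?thesis using native_space_scale_le[OF assms, of a] by simp
qed

lemma norm_sq_minus: "h \<in> native_space \<Longrightarrow> u \<in> native_space \<Longrightarrow> norm_sq (\<lambda>x. h x - u x) = norm_sq (\<lambda>x. u x - h x)"
  using norm_sq_scale[of "\<lambda>x. u x - h x" "-1"] native_space_diff[of u h] by simp

lemma parallelogram_le:
  assumes h: "h \<in> native_space" and u: "u \<in> native_space"
  shows "norm_sq (\<lambda>x. h x + u x) + norm_sq (\<lambda>x. h x - u x) \<le> 2 * norm_sq h + 2 * norm_sq u"
proof -
  have "norm_sq (\<lambda>x. h x - u x) \<le> 2 * norm_sq h + 2 * norm_sq u - energy (\<lambda>x. h x + u x) cs"
    if "cs \<in> combos X" for cs
    using energy_parallelogram[OF h u that] by (intro norm_sq_le) (simp add: algebra_simps)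
  then have "norm_sq (\<lambda>x. h x + u x) \<le> 2 * norm_sq h + 2 * norm_sq u - norm_sq (\<lambda>x. h x - u x)"
    by (intro norm_sq_le) (fastforce simp: algebra_simps)
  then show ?thesis by simp
qed

text \<open>
  The reverse inequality is the inequality already proved, applied to \<open>h + u\<close> and \<open>h - u\<close>.
\<close>
lemma parallelogram:
  assumes h: "h \<in> native_space" and u: "u \<in> native_space"
  shows "norm_sq (\<lambda>x. h x + u x) + norm_sq (\<lambda>x. h x - u x) = 2 * norm_sq h + 2 * norm_sq u"
proof -
  have "norm_sq (\<lambda>x. (h x + u x) + (h x - u x)) + norm_sq (\<lambda>x. (h x + u x) - (h x - u x))
      \<le> 2 * norm_sq (\<lambda>x. h x + u x) + 2 * norm_sq (\<lambda>x. h x - u x)"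
    by (intro parallelogram_le native_space_add native_space_diff h u)
  moreover have "norm_sq (\<lambda>x. (h x + u x) + (h x - u x)) = 4 * norm_sq h"
    using norm_sq_scale[OF h, of 2] by simp
  moreover have "norm_sq (\<lambda>x. (h x + u x) - (h x - u x)) = 4 * norm_sq u"
    using norm_sq_scale[OF u, of 2] by simp
  ultimately show ?thesis using parallelogram_le[OF h u] by simp
qed

lemma norm_sq_eq_0:
  assumes "h \<in> native_space" "norm_sq h = 0"
  shows "h = (\<lambda>x. 0)"
proof
  fix x show "h x = 0"
    using value_bound[OF assms(1), of x] assms native_space_off[of h x] by (cases "x \<in> X") auto
qed

lemma norm_triangle:
  assumes h: "h \<in> native_space" and u: "u \<in> native_space"
  shows "sqrt (norm_sq (\<lambda>x. h x + u x)) \<le> sqrt (norm_sq h) + sqrt (norm_sq u)"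
proof -
  have b: "cmod (pairing h cs) \<le> sqrt (norm_sq h) * sqrt (sq_norm k cs)"
    if "h \<in> native_space" "cs \<in> combos X" for h cs
    using pairing_bound[OF that] by (simp add: real_le_rsqrt real_sqrt_mult[symmetric])
  have "norm_sq (\<lambda>x. h x + u x) \<le> (sqrt (norm_sq h) + sqrt (norm_sq u))\<^sup>2"
  proof (rule norm_sq_leI)
    fix cs assume cs: "cs \<in> combos X"
    show "cmod (pairing (\<lambda>x. h x + u x) cs) \<le> (sqrt (norm_sq h) + sqrt (norm_sq u)) * sqrt (sq_norm k cs)"
      using b[OF h cs] b[OF u cs] norm_triangle_ineq[of "pairing h cs" "pairing u cs"]
      by (simp add: pairing_fun_add algebra_simps)
  qed (simp add: norm_sq_nonneg h u)
  then show ?thesis using norm_sq_nonneg[OF h] norm_sq_nonneg[OF u]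
    by (intro real_le_lsqrt) auto
qed

text \<open>
  Completing the square: adding a combination to the function amounts to translating the combination
  at which the energy is evaluated.
\<close>
lemma comb_energy:
  assumes "ds \<in> combos X" "cs \<in> combos X"
  shows "energy (\<lambda>x. h x + zero_ext X (comb k ds) x) cs
    = energy h (cs @ scale_combo (-1) ds) + 2 * Re (pairing h ds) + sq_norm k ds"
  using assms pairing_comb_sym[OF assms]
  by (simp add: energy_def pairing_fun_add sq_norm_append sq_norm_scale_combo)

lemma native_space_add_comb:
  assumes h: "h \<in> native_space" and ds: "ds \<in> combos X"
  shows "(\<lambda>x. h x + zero_ext X (comb k ds) x) \<in> native_space"
  using comb_energy[OF ds] energy_le[OF h] ds
  by (intro native_spaceI[where M = "norm_sq h + 2 * Re (pairing h ds) + sq_norm k ds"])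
    (auto simp: fun_on_def native_space_off[OF h] zero_ext_def)

lemma native_space_comb: "ds \<in> combos X \<Longrightarrow> zero_ext X (comb k ds) \<in> native_space"
  using native_space_add_comb[OF native_space_zero] by simp

lemma norm_sq_add_comb:
  assumes h: "h \<in> native_space" and ds: "ds \<in> combos X"
  shows "norm_sq (\<lambda>x. h x + zero_ext X (comb k ds) x) = norm_sq h + 2 * Re (pairing h ds) + sq_norm k ds"
proof -
  have le: "norm_sq (\<lambda>x. h x + zero_ext X (comb k ds) x) \<le> norm_sq h + 2 * Re (pairing h ds) + sq_norm k ds"
    if h: "h \<in> native_space" and ds: "ds \<in> combos X" for h ds
    using comb_energy[OF ds] energy_le[OF h] ds by (intro norm_sq_le) auto
  let ?u = "\<lambda>x. h x + zero_ext X (comb k ds) x"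
  have "norm_sq (\<lambda>x. ?u x + zero_ext X (comb k (scale_combo (-1) ds)) x)
      \<le> norm_sq ?u + 2 * Re (pairing ?u (scale_combo (-1) ds)) + sq_norm k (scale_combo (-1) ds)"
    using ds by (intro le native_space_add_comb h) auto
  also have "(\<lambda>x. ?u x + zero_ext X (comb k (scale_combo (-1) ds)) x) = h"
    by (auto simp: zero_ext_def)
  finally show ?thesis using le[OF h ds] ds
    by (simp add: pairing_fun_add sq_norm_scale_combo) (simp add: sq_norm_def)
qed

lemma norm_sq_comb: "ds \<in> combos X \<Longrightarrow> norm_sq (zero_ext X (comb k ds)) = sq_norm k ds"
  using norm_sq_add_comb[OF native_space_zero, of ds] norm_sq_scale[OF native_space_zero, of 0]
  by (simp add:)

end

section \<open>The inner product and completeness\<close>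

text \<open>
  After subtracting the linear function with the same value at 1, what remains is additive and has
  period 1, hence is bounded on the whole line; a bounded additive function vanishes.
\<close>
lemma additive_locally_bounded_imp_linear:
  fixes \<phi> :: "real \<Rightarrow> real"
  assumes add: "\<And>s t. \<phi> (s + t) = \<phi> s + \<phi> t"
    and bound: "\<And>t. 0 \<le> t \<Longrightarrow> t \<le> 1 \<Longrightarrow> \<bar>\<phi> t\<bar> \<le> M"
  shows "\<phi> t = t * \<phi> 1"
proof -
  define \<psi> where "\<psi> t = \<phi> t - t * \<phi> 1" for t
  have \<psi>add: "\<psi> (s + t) = \<psi> s + \<psi> t" for s t
    by (simp add: \<psi>_def add algebra_simps)
  have \<psi>0: "\<psi> 0 = 0" using \<psi>add[of 0 0] by simp
  have mult: "\<psi> (of_nat n * s) = of_nat n * \<psi> s" for n s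
    by (induction n) (simp_all add: \<psi>0 \<psi>add algebra_simps)
  have neg: "\<psi> (- s) = - \<psi> s" for s using \<psi>add[of s "-s"] \<psi>0 by simp
  have one: "\<psi> 1 = 0" by (simp add: \<psi>_def)
  have int: "\<psi> (of_int m) = 0" for m
    using mult[of "nat \<bar>m\<bar>" 1] neg[of "of_nat (nat \<bar>m\<bar>)"] one by (cases "m \<ge> 0") auto
  have bdd: "\<bar>\<psi> s\<bar> \<le> M + \<bar>\<phi> 1\<bar>" for s
  proof -
    have "\<psi> s = \<psi> (frac s)"
      using \<psi>add[of "of_int \<lfloor>s\<rfloor>" "frac s"] int by (simp add: frac_def)
    moreover have "\<bar>frac s * \<phi> 1\<bar> \<le> \<bar>\<phi> 1\<bar>"
      using frac_lt_1[of s] by (simp add: abs_mult mult_left_le_one_le)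
    moreover have "\<bar>\<phi> (frac s)\<bar> \<le> M" using bound[of "frac s"] frac_lt_1[of s] by simp
    ultimately show ?thesis unfolding \<psi>_def by linarith
  qed
  have "\<psi> t = 0"
  proof (rule ccontr)
    assume nz: "\<psi> t \<noteq> 0"
    obtain n :: nat where "of_nat n > (M + \<bar>\<phi> 1\<bar>) / \<bar>\<psi> t\<bar>" using reals_Archimedean2 by blast
    then have "of_nat n * \<bar>\<psi> t\<bar> > M + \<bar>\<phi> 1\<bar>" using nz by (simp add: field_simps)
    then show False using bdd[of "of_nat n * t"] mult[of n t] by (simp add: abs_mult)
  qed
  then show ?thesis by (simp add: \<psi>_def)
qed

context psd_kernel
begin

text \<open>
  Polarization of the squared norm. The imaginary part of the inner product is then forced by
  \<open>Im \<langle>h, u\<rangle> = Re \<langle>h, \<i> u\<rangle>\<close>, since the product is linear in the first argument.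
\<close>
definition re_inner :: "('a \<Rightarrow> complex) \<Rightarrow> ('a \<Rightarrow> complex) \<Rightarrow> real" where
  "re_inner h u = (norm_sq (\<lambda>x. h x + u x) - norm_sq (\<lambda>x. h x - u x)) / 4"

definition inner_prod :: "('a \<Rightarrow> complex) \<Rightarrow> ('a \<Rightarrow> complex) \<Rightarrow> complex" where
  "inner_prod h u = Complex (re_inner h u) (re_inner h (\<lambda>x. \<i> * u x))"

text \<open>
  The classical argument of Jordan and von Neumann: four instances of the parallelogram law are
  combined so that the unwanted terms cancel in pairs by evenness of the norm.
\<close>
lemma re_inner_add:
  assumes "h \<in> native_space" "h' \<in> native_space" "u \<in> native_space"
  shows "re_inner (\<lambda>x. h x + h' x) u = re_inner h u + re_inner h' u"
proof -
  note sp = assms native_space_add native_space_diff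
  have "norm_sq (\<lambda>x. (h x + u x) + h' x) + norm_sq (\<lambda>x. (h x + u x) - h' x)
      = 2 * norm_sq (\<lambda>x. h x + u x) + 2 * norm_sq h'"
    "norm_sq (\<lambda>x. (h x - u x) + h' x) + norm_sq (\<lambda>x. (h x - u x) - h' x)
      = 2 * norm_sq (\<lambda>x. h x - u x) + 2 * norm_sq h'"
    "norm_sq (\<lambda>x. (h' x + u x) + h x) + norm_sq (\<lambda>x. (h' x + u x) - h x)
      = 2 * norm_sq (\<lambda>x. h' x + u x) + 2 * norm_sq h"
    "norm_sq (\<lambda>x. (h' x - u x) + h x) + norm_sq (\<lambda>x. (h' x - u x) - h x)
      = 2 * norm_sq (\<lambda>x. h' x - u x) + 2 * norm_sq h"
    by (intro parallelogram sp)+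
  moreover have "norm_sq (\<lambda>x. (h x + u x) - h' x) = norm_sq (\<lambda>x. (h' x - u x) - h x)"
    using norm_sq_minus[of "\<lambda>x. h x + u x" h'] sp by (simp add: algebra_simps)
  moreover have "norm_sq (\<lambda>x. (h x - u x) - h' x) = norm_sq (\<lambda>x. (h' x + u x) - h x)"
    using norm_sq_minus[of "\<lambda>x. h x - u x" h'] sp by (simp add: algebra_simps)
  moreover have "(\<lambda>x. (h x + u x) + h' x) = (\<lambda>x. (h x + h' x) + u x)"
    "(\<lambda>x. (h' x + u x) + h x) = (\<lambda>x. (h x + h' x) + u x)"
    "(\<lambda>x. (h x - u x) + h' x) = (\<lambda>x. (h x + h' x) - u x)"
    "(\<lambda>x. (h' x - u x) + h x) = (\<lambda>x. (h x + h' x) - u x)"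
    by (auto simp: algebra_simps)
  ultimately show ?thesis unfolding re_inner_def by (simp add: field_simps)
qed

lemma re_inner_sym: "h \<in> native_space \<Longrightarrow> u \<in> native_space \<Longrightarrow> re_inner h u = re_inner u h"
  using norm_sq_minus[of h u] by (simp add: re_inner_def add.commute)

lemma re_inner_bound:
  assumes "h \<in> native_space" "u \<in> native_space"
  shows "\<bar>re_inner h u\<bar> \<le> norm_sq h + norm_sq u"
proof -
  have "0 \<le> norm_sq (\<lambda>x. h x + u x)" "0 \<le> norm_sq (\<lambda>x. h x - u x)"
    "0 \<le> norm_sq h" "0 \<le> norm_sq u"
    by (intro norm_sq_nonneg native_space_add native_space_diff assms)+
  then show ?thesis using parallelogram[OF assms] by (auto simp: re_inner_def)
qed

lemma re_inner_scale_real: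
  assumes h: "h \<in> native_space" and u: "u \<in> native_space"
  shows "re_inner (\<lambda>x. of_real t * h x) u = t * re_inner h u"
proof -
  define \<phi> where "\<phi> t = re_inner (\<lambda>x. of_real t * h x) u" for t
  have "\<phi> t = t * \<phi> 1"
  proof (rule additive_locally_bounded_imp_linear)
    show "\<phi> (s + t) = \<phi> s + \<phi> t" for s t
      using re_inner_add[OF native_space_scale[OF h] native_space_scale[OF h] u, of "of_real s" "of_real t"]
      by (simp add: \<phi>_def algebra_simps)
  next
    fix t :: real assume t: "0 \<le> t" "t \<le> 1"
    have "\<bar>\<phi> t\<bar> \<le> t\<^sup>2 * norm_sq h + norm_sq u"
      using re_inner_bound[OF native_space_scale[OF h] u, of "of_real t"] norm_sq_scale[OF h]
      by (simp add: \<phi>_def)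
    also have "\<dots> \<le> 1 * norm_sq h + norm_sq u"
      using t norm_sq_nonneg[OF h] by (intro add_mono mult_right_mono) (auto simp: power_le_one)
    finally show "\<bar>\<phi> t\<bar> \<le> norm_sq h + norm_sq u" by simp
  qed
  then show ?thesis by (simp add: \<phi>_def)
qed

lemma re_inner_i:
  assumes h: "h \<in> native_space" and u: "u \<in> native_space"
  shows "re_inner (\<lambda>x. \<i> * h x) u = - re_inner h (\<lambda>x. \<i> * u x)"
proof -
  have 1: "(\<lambda>x. \<i> * h x + u x) = (\<lambda>x. \<i> * (h x - \<i> * u x))"
    "(\<lambda>x. \<i> * h x - u x) = (\<lambda>x. \<i> * (h x + \<i> * u x))"
    by (auto simp: algebra_simps)
  have "norm_sq (\<lambda>x. \<i> * (h x - \<i> * u x)) = norm_sq (\<lambda>x. h x - \<i> * u x)"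
    "norm_sq (\<lambda>x. \<i> * (h x + \<i> * u x)) = norm_sq (\<lambda>x. h x + \<i> * u x)"
    using norm_sq_scale[OF native_space_diff[OF h native_space_scale[OF u]], of \<i> \<i>]
      norm_sq_scale[OF native_space_add[OF h native_space_scale[OF u]], of \<i> \<i>] by simp_all
  then show ?thesis unfolding re_inner_def 1 by (simp add: field_simps)
qed

lemma inner_prod_scale:
  assumes h: "h \<in> native_space" and u: "u \<in> native_space"
  shows "inner_prod (\<lambda>x. c * h x) u = c * inner_prod h u"
proof -
  have *: "re_inner (\<lambda>x. c * h x) v = Re c * re_inner h v - Im c * re_inner h (\<lambda>x. \<i> * v x)"
    if v: "v \<in> native_space" for v
  proof -
    have "c = of_real (Re c) + of_real (Im c) * \<i>"
      by (simp add: complex_eq_iff)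
    then have "(\<lambda>x. c * h x) = (\<lambda>x. of_real (Re c) * h x + of_real (Im c) * (\<i> * h x))"
      by (metis (no_types, opaque_lifting) distrib_right mult.assoc)
    then have "re_inner (\<lambda>x. c * h x) v
        = re_inner (\<lambda>x. of_real (Re c) * h x) v + re_inner (\<lambda>x. of_real (Im c) * (\<i> * h x)) v"
      by (simp only:) (intro re_inner_add native_space_scale h v)
    also have "re_inner (\<lambda>x. of_real (Im c) * (\<i> * h x)) v = Im c * re_inner (\<lambda>x. \<i> * h x) v"
      by (intro re_inner_scale_real native_space_scale h v)
    finally show ?thesis by (simp only: re_inner_scale_real[OF h v] re_inner_i[OF h v])
  qed
  have "re_inner h (\<lambda>x. \<i> * (\<i> * u x)) = - re_inner h u"
    using re_inner_i[OF h native_space_scale[OF u], of \<i>] re_inner_i[OF native_space_scale[OF h] u, of \<i>]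
      re_inner_scale_real[OF h u, of "-1"] by (simp add: mult.assoc[symmetric])
  then show ?thesis using *[OF u] *[OF native_space_scale[OF u], of \<i>]
    by (simp add: inner_prod_def complex_eq_iff)
qed

lemma inner_prod_cnj:
  assumes h: "h \<in> native_space" and u: "u \<in> native_space"
  shows "inner_prod u h = cnj (inner_prod h u)"
  using re_inner_sym[OF h u] re_inner_sym[OF u native_space_scale[OF h], of \<i>] re_inner_i[OF h u]
  by (simp add: inner_prod_def complex_eq_iff)

lemma inner_prod_self:
  assumes h: "h \<in> native_space"
  shows "inner_prod h h = of_real (norm_sq h)"
proof -
  have "re_inner h h = norm_sq h"
    using norm_sq_scale[OF h, of 2] norm_sq_scale[OF h, of 0] by (simp add: re_inner_def)
  then show ?thesis
    using inner_prod_cnj[OF h h] by (simp add: inner_prod_def complex_eq_iff)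
qed

text \<open>
  The reproducing property, for all combinations of kernel functions at once; it is read off from the
  exact formula \<open>norm_sq_add_comb\<close>.
\<close>
lemma inner_prod_comb:
  assumes h: "h \<in> native_space" and ds: "ds \<in> combos X"
  shows "inner_prod h (zero_ext X (comb k ds)) = pairing h ds"
proof -
  have *: "re_inner h (zero_ext X (comb k ds)) = Re (pairing h ds)" if ds: "ds \<in> combos X" for ds
  proof -
    have "(\<lambda>x. h x - zero_ext X (comb k ds) x) = (\<lambda>x. h x + zero_ext X (comb k (scale_combo (-1) ds)) x)"
      by (auto simp: zero_ext_def)
    then show ?thesis using ds unfolding re_inner_def
      by (simp only: norm_sq_add_comb[OF h] combos_simps pairing_scale_combo sq_norm_scale_combo) simp
  qed
  have "(\<lambda>x. \<i> * zero_ext X (comb k ds) x) = zero_ext X (comb k (scale_combo \<i> ds))"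
    by (auto simp: zero_ext_def)
  then show ?thesis using *[OF ds] *[of "scale_combo \<i> ds"] ds
    by (simp add: inner_prod_def complex_eq_iff)
qed

lemma value_bound_sqrt:
  assumes "h \<in> native_space" "x \<in> X"
  shows "cmod (h x) \<le> sqrt (norm_sq h) * sqrt (Re (k x x))"
  using value_bound[OF assms] by (simp add: real_le_rsqrt real_sqrt_mult[symmetric])

lemma norm_tendsto_0_pointwise:
  assumes s: "\<And>n. s n \<in> native_space" and h: "h \<in> native_space"
    and lim: "(\<lambda>n. sqrt (norm_sq (\<lambda>x. s n x - h x))) \<longlonglongrightarrow> 0"
  shows "(\<lambda>n. s n x) \<longlonglongrightarrow> h x"
proof (cases "x \<in> X")
  case True
  have "(\<lambda>n. s n x - h x) \<longlonglongrightarrow> 0"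
  proof (rule tendsto_0_le[OF lim])
    show "\<forall>\<^sub>F n in sequentially. norm (s n x - h x)
        \<le> norm (sqrt (norm_sq (\<lambda>x. s n x - h x))) * sqrt (Re (k x x))"
      using value_bound_sqrt[OF native_space_diff[OF s h] True] norm_sq_nonneg[OF native_space_diff[OF s h]]
      by (intro always_eventually allI) simp
  qed
  then show ?thesis by (rule LIM_zero_cancel)
next
  case False
  then show ?thesis using s h by (simp add: native_space_off)
qed

text \<open>
  Evaluations are bounded, so a Cauchy sequence converges pointwise. For a fixed combination the energy
  depends on finitely many values only and passes to the pointwise limit, which bounds the
  norm of the limit and of the differences.
\<close>
lemma native_space_complete:
  assumes s: "\<And>n. s n \<in> native_space"
    and cau: "\<forall>e>0. \<exists>N. \<forall>m\<ge>N. \<forall>n\<ge>N. sqrt (norm_sq (\<lambda>x. s m x - s n x)) < e"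
  shows "\<exists>h\<in>native_space. (\<lambda>n. sqrt (norm_sq (\<lambda>x. s n x - h x))) \<longlonglongrightarrow> 0"
proof -
  have "\<exists>l. (\<lambda>n. s n x) \<longlonglongrightarrow> l" for x
  proof (cases "x \<in> X")
    case True
    have "Cauchy (\<lambda>n. s n x)"
    proof (rule metric_CauchyI)
      fix e :: real assume e: "0 < e"
      let ?K = "sqrt (Re (k x x))"
      have K: "?K \<ge> 0" using psd[of "[(1, x)]"] True by (simp add: sq_norm_def)
      obtain N where N: "\<And>m n. m \<ge> N \<Longrightarrow> n \<ge> N \<Longrightarrow> sqrt (norm_sq (\<lambda>x. s m x - s n x)) < e / (?K + 1)"
        using cau e K by (metis add_nonneg_pos divide_pos_pos zero_less_one)
      have "dist (s m x) (s n x) < e" if "m \<ge> N" "n \<ge> N" for m n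
      proof -
        let ?a = "sqrt (norm_sq (\<lambda>x. s m x - s n x))"
        have a0: "0 \<le> ?a" using norm_sq_nonneg[OF native_space_diff[OF s s]] by simp
        have "dist (s m x) (s n x) \<le> ?a * ?K"
          unfolding dist_norm by (rule value_bound_sqrt[OF native_space_diff[OF s s] True])
        also have "\<dots> \<le> ?a * (?K + 1)" using a0 by (simp add: algebra_simps)
        also have "\<dots> < e" using N[OF that] K by (simp add: pos_less_divide_eq)
        finally show ?thesis .
      qed
      then show "\<exists>M. \<forall>m\<ge>M. \<forall>n\<ge>M. dist (s m x) (s n x) < e" by blast
    qed
    then show ?thesis by (metis Cauchy_convergent convergent_def)
  next
    case False
    then show ?thesis using s by (auto simp: native_space_off)
  qed
  then obtain h where h: "\<And>x. (\<lambda>n. s n x) \<longlonglongrightarrow> h x" by metis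
  have hoff: "h \<in> fun_on X"
  proof -
    have "h x = 0" if "x \<notin> X" for x
      using LIMSEQ_unique[OF h[of x]] that s by (simp add: native_space_off)
    then show ?thesis by (simp add: fun_on_def)
  qed
  have key: "\<exists>N. \<forall>n\<ge>N. (\<lambda>x. s n x - h x) \<in> native_space \<and> norm_sq (\<lambda>x. s n x - h x) \<le> e\<^sup>2" if e: "e > 0" for e
  proof -
    obtain N where N: "\<And>m n. m \<ge> N \<Longrightarrow> n \<ge> N \<Longrightarrow> sqrt (norm_sq (\<lambda>x. s m x - s n x)) < e"
      using cau e by blast
    have "energy (\<lambda>x. s n x - h x) cs \<le> e\<^sup>2" if n: "n \<ge> N" and cs: "cs \<in> combos X" for n cs
    proof (rule LIMSEQ_le_const2)
      show "(\<lambda>m. energy (\<lambda>x. s n x - s m x) cs) \<longlonglongrightarrow> energy (\<lambda>x. s n x - h x) cs"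
        unfolding energy_def by (intro tendsto_intros pairing_tendsto[OF _ cs] h)
      have "energy (\<lambda>x. s n x - s m x) cs \<le> e\<^sup>2" if "m \<ge> N" for m
      proof -
        have "norm_sq (\<lambda>x. s n x - s m x) < e\<^sup>2"
          using N[OF n that] by (meson not_le real_le_rsqrt)
        then show ?thesis using energy_le[OF native_space_diff[OF s s] cs] by (meson less_imp_le order_trans)
      qed
      then show "\<exists>M. \<forall>m\<ge>M. energy (\<lambda>x. s n x - s m x) cs \<le> e\<^sup>2" by blast
    qed
    then show ?thesis using s hoff
      by (intro exI[of _ N]) (auto intro!: norm_sq_le native_spaceI[where M = "e\<^sup>2"] simp: fun_on_def native_space_off)
  qed
  obtain n where "(\<lambda>x. s n x - h x) \<in> native_space" using key[of 1] by auto
  then have hs: "h \<in> native_space" using native_space_diff[OF s[of n], of "\<lambda>x. s n x - h x"] by simp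
  have "(\<lambda>n. sqrt (norm_sq (\<lambda>x. s n x - h x))) \<longlonglongrightarrow> 0"
  proof (rule LIMSEQ_I)
    fix e :: real assume e: "e > 0"
    obtain N where N: "\<And>n. n \<ge> N \<Longrightarrow> norm_sq (\<lambda>x. s n x - h x) \<le> (e/2)\<^sup>2"
      using key[of "e/2"] e by auto
    have "norm (sqrt (norm_sq (\<lambda>x. s n x - h x)) - 0) < e" if "n \<ge> N" for n
    proof -
      have "sqrt (norm_sq (\<lambda>x. s n x - h x)) \<le> e / 2"
        using N[OF that] e by (intro real_le_lsqrt) auto
      then show ?thesis using e norm_sq_nonneg[OF native_space_diff[OF s hs]] by simp
    qed
    then show "\<exists>no. \<forall>n\<ge>no. norm (sqrt (norm_sq (\<lambda>x. s n x - h x)) - 0) < e" by blast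
  qed
  then show ?thesis using hs by blast
qed

theorem is_rkhs_native_space: "is_rkhs X k native_space inner_prod"
proof
  show "native_space \<subseteq> fun_on X" by (auto simp: native_space_def)
next
  fix h h' u assume "h \<in> native_space" "h' \<in> native_space" "u \<in> native_space"
  then show "inner_prod (\<lambda>x. h x + h' x) u = inner_prod h u + inner_prod h' u"
    by (simp add: inner_prod_def re_inner_add native_space_scale complex_eq_iff)
next
  fix h assume h: "h \<in> native_space"
  show "0 \<le> Re (inner_prod h h)" using norm_sq_nonneg[OF h] by (simp add: inner_prod_self h)
  assume "inner_prod h h = 0"
  then show "h = (\<lambda>x. 0)" using norm_sq_eq_0[OF h] by (simp add: inner_prod_self h)
next
  fix s :: "nat \<Rightarrow> 'a \<Rightarrow> complex"
  assume s: "\<And>n. s n \<in> native_space"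
    and "\<forall>e>0. \<exists>N. \<forall>m\<ge>N. \<forall>n\<ge>N.
      sqrt (Re (inner_prod (\<lambda>x. s m x - s n x) (\<lambda>x. s m x - s n x))) < e"
  then have "\<exists>h\<in>native_space. (\<lambda>n. sqrt (norm_sq (\<lambda>x. s n x - h x))) \<longlonglongrightarrow> 0"
    by (intro native_space_complete) (simp_all add: inner_prod_self native_space_diff)
  then show "\<exists>h\<in>native_space.
      (\<lambda>n. sqrt (Re (inner_prod (\<lambda>x. s n x - h x) (\<lambda>x. s n x - h x)))) \<longlonglongrightarrow> 0"
    by (auto simp: inner_prod_self native_space_diff s intro!: bexI)
next
  fix w assume w: "w \<in> X"
  then show "zero_ext X (\<lambda>z. k z w) \<in> native_space" using native_space_comb[of "[(1, w)]"] by simp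
  fix h assume "h \<in> native_space"
  then show "h w = inner_prod h (zero_ext X (\<lambda>z. k z w))"
    using inner_prod_comb[of h "[(1, w)]"] w by simp
qed (use native_space_zero native_space_add native_space_scale inner_prod_scale inner_prod_cnj in blast)+

section \<open>Uniqueness of the space with a given kernel\<close>

text \<open>
  In any Hilbert space with this kernel, the energy of \<open>h\<close> at a combination \<open>u\<close> is
  \<open>|h|^2 - |h - u|^2\<close> and so at most \<open>|h|^2\<close>.
\<close>
lemma rkhs_subset_native_space:
  assumes "is_rkhs X k H ip"
  shows "H \<subseteq> native_space" and "h \<in> H \<Longrightarrow> norm_sq h \<le> Re (ip h h)"
    and "cs \<in> combos X \<Longrightarrow> zero_ext X (comb k cs) \<in> H"
    and "cs \<in> combos X \<Longrightarrow> h \<in> H \<Longrightarrow> ip h (zero_ext X (comb k cs)) = pairing h cs"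
proof -
  interpret H: is_rkhs X k H ip by fact
  have antilin: "ip h (\<lambda>x. c * u x + v x) = cnj c * ip h u + ip h v"
    if "h \<in> H" "u \<in> H" "v \<in> H" for c h u v
    using that H.ip_cnj[of "\<lambda>x. c * u x + v x" h] H.ip_add[of "\<lambda>x. c * u x" v h]
      H.ip_scale[of u h c] H.ip_cnj[of u h] H.ip_cnj[of v h] H.add_mem H.scale_mem by simp
  have *: "zero_ext X (comb k cs) \<in> H \<and> (\<forall>h\<in>H. ip h (zero_ext X (comb k cs)) = pairing h cs)"
    if "cs \<in> combos X" for cs
    using that
  proof (induction cs)
    case Nil
    have "zero_ext X (\<lambda>y. 0) = (\<lambda>x. 0)" by (simp add: zero_ext_def)
    moreover have "ip h (\<lambda>x. 0) = 0" if "h \<in> H" for h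
      using antilin[OF that H.zero_mem H.zero_mem, of 1] by simp
    ultimately show ?case using H.zero_mem by simp
  next
    case (Cons p cs)
    obtain c w where p: "p = (c, w)" by force
    have w: "w \<in> X" and cs: "cs \<in> combos X" using Cons.prems by (auto simp: p)
    have "zero_ext X (comb k (p # cs))
        = (\<lambda>x. c * zero_ext X (\<lambda>z. k z w) x + zero_ext X (comb k cs) x)"
      by (auto simp: p zero_ext_def)
    then show ?case
      using Cons.IH[OF cs] H.kernel_mem[OF w] H.reproducing[OF _ w]
      by (auto simp: p antilin intro!: H.add_mem H.scale_mem)
  qed
  show "cs \<in> combos X \<Longrightarrow> zero_ext X (comb k cs) \<in> H"
    and "cs \<in> combos X \<Longrightarrow> h \<in> H \<Longrightarrow> ip h (zero_ext X (comb k cs)) = pairing h cs"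
    using * by blast+
  have en: "energy h cs \<le> Re (ip h h)" if h: "h \<in> H" and cs: "cs \<in> combos X" for h cs
  proof -
    let ?u = "zero_ext X (comb k cs)"
    have u: "?u \<in> H" and ip: "\<And>h. h \<in> H \<Longrightarrow> ip h ?u = pairing h cs" using * cs by auto
    let ?d = "\<lambda>x. (-1) * ?u x + h x"
    have d: "?d \<in> H" by (intro H.add_mem H.scale_mem u h)
    have "ip ?d ?d = - ip ?d ?u + ip ?d h" using antilin[OF d u h, of "-1"] by simp
    also have "ip ?d ?u = - pairing ?u cs + pairing h cs"
      by (simp only: ip[OF d] pairing_fun_add pairing_fun_scale pairing_zero_ext[OF cs])
        (simp add: cs)
    also have "ip ?d h = cnj (- pairing h cs + ip h h)"
      using H.ip_cnj[OF h d] antilin[OF h u h, of "-1"] ip[OF h] by simp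
    finally have "Re (ip ?d ?d) = Re (ip h h) - energy h cs"
      using cs by (simp add: energy_def sq_norm_def)
    then show ?thesis using H.ip_nonneg[OF d] by simp
  qed
  show "H \<subseteq> native_space"
    using en H.subset_fun_on by (blast intro: native_spaceI)
  show "norm_sq h \<le> Re (ip h h)" if "h \<in> H" using en that by (intro norm_sq_le) auto
qed

text \<open>
  Combinations \<open>cs n\<close> at which the energy of \<open>h\<close> nearly attains its supremum form a Cauchy sequence, by
  the parallelogram law, as in the proof of the projection theorem. Their norms are determined by the
  kernel alone, so the sequence is Cauchy also in the given space \<open>H\<close>; its limit there agrees pointwise
  with \<open>h\<close>.
\<close>
lemma native_space_subset_rkhs:
  assumes rk: "is_rkhs X k H ip"
  shows "native_space \<subseteq> H"
proof
  interpret H: is_rkhs X k H ip by fact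
  fix h assume h: "h \<in> native_space"
  let ?c = "\<lambda>cs. zero_ext X (comb k cs)"
  have "\<exists>cs\<in>combos X. norm_sq h - 1 / Suc n < energy h cs" for n
  proof (rule ccontr)
    assume "\<not> ?thesis"
    then have "norm_sq h \<le> norm_sq h - 1 / Suc n" by (intro norm_sq_le) (auto simp: not_less)
    then show False by simp
  qed
  then obtain cs where cs: "\<And>n. cs n \<in> combos X"
    and en: "\<And>n. norm_sq h - 1 / Suc n < energy h (cs n)" by metis
  have diff: "?c as x - ?c bs x = ?c (as @ scale_combo (-1) bs) x" for as bs x
    by (simp add: zero_ext_def)
  have ipc: "Re (ip (?c as) (?c as)) = sq_norm k as" if "as \<in> combos X" for as
    using rkhs_subset_native_space(3,4)[OF rk] that by (simp add: sq_norm_def)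
  have near: "sq_norm k (cs m @ scale_combo (-1) (cs n)) \<le> 2 / Suc m + 2 / Suc n" for m n
  proof -
    let ?p = "scale_combo (1/2) (cs m @ cs n)"
    have "sq_norm k (cs m @ scale_combo (-1) (cs n))
        = 4 * energy h ?p - 2 * energy h (cs m) - 2 * energy h (cs n)"
      using cs by (simp add: energy_def sq_norm_scale_combo sq_norm_append norm_divide field_simps)
    moreover have "energy h ?p \<le> norm_sq h" using cs by (intro energy_le h) auto
    ultimately show ?thesis using en[of m] en[of n] by linarith
  qed
  have "\<exists>h'\<in>H. (\<lambda>n. sqrt (Re (ip (\<lambda>x. ?c (cs n) x - h' x) (\<lambda>x. ?c (cs n) x - h' x)))) \<longlonglongrightarrow> 0"
  proof (rule H.ip_complete)
    show "?c (cs n) \<in> H" for n using rkhs_subset_native_space(3)[OF rk cs] .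
    show "\<forall>e>0. \<exists>N. \<forall>m\<ge>N. \<forall>n\<ge>N. sqrt (Re (ip (\<lambda>x. ?c (cs m) x - ?c (cs n) x)
        (\<lambda>x. ?c (cs m) x - ?c (cs n) x))) < e"
    proof (intro allI impI)
      fix e :: real assume e: "e > 0"
      obtain N where N: "1 / Suc N < e\<^sup>2 / 4"
        using nat_approx_posE[of "e\<^sup>2 / 4"] e by auto
      have "sqrt (Re (ip (\<lambda>x. ?c (cs m) x - ?c (cs n) x) (\<lambda>x. ?c (cs m) x - ?c (cs n) x))) < e"
        if "m \<ge> N" "n \<ge> N" for m n
      proof -
        have "1 / real (Suc m) \<le> 1 / Suc N" "1 / real (Suc n) \<le> 1 / Suc N"
          using that by (auto simp: field_simps)
        then have "sq_norm k (cs m @ scale_combo (-1) (cs n)) < e\<^sup>2" using near[of m n] N by linarith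
        then show ?thesis using e cs
          unfolding diff by (subst ipc) (auto intro: real_less_lsqrt)
      qed
      then show "\<exists>N. \<forall>m\<ge>N. \<forall>n\<ge>N. sqrt (Re (ip (\<lambda>x. ?c (cs m) x - ?c (cs n) x)
        (\<lambda>x. ?c (cs m) x - ?c (cs n) x))) < e" by blast
    qed
  qed
  then obtain h' where h': "h' \<in> H"
    and lim: "(\<lambda>n. sqrt (Re (ip (\<lambda>x. ?c (cs n) x - h' x) (\<lambda>x. ?c (cs n) x - h' x)))) \<longlonglongrightarrow> 0"
    by blast
  have h's: "h' \<in> native_space" using rkhs_subset_native_space(1)[OF rk] h' by blast
  have lim': "(\<lambda>n. sqrt (norm_sq (\<lambda>x. ?c (cs n) x - h' x))) \<longlonglongrightarrow> 0"
  proof (rule tendsto_sandwich[OF _ _ tendsto_const lim])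
    have "(\<lambda>x. ?c (cs n) x - h' x) \<in> H" for n
      using H.add_mem[OF rkhs_subset_native_space(3)[OF rk cs] H.scale_mem[OF h', of "-1"]] by simp
    then show "\<forall>\<^sub>F n in sequentially. sqrt (norm_sq (\<lambda>x. ?c (cs n) x - h' x))
        \<le> sqrt (Re (ip (\<lambda>x. ?c (cs n) x - h' x) (\<lambda>x. ?c (cs n) x - h' x)))"
      by (intro always_eventually allI real_sqrt_le_mono rkhs_subset_native_space(2)[OF rk])
  qed (use norm_sq_nonneg[OF native_space_diff[OF native_space_comb[OF cs] h's]] in auto)
  have lim2: "(\<lambda>n. sqrt (norm_sq (\<lambda>x. ?c (cs n) x - h x))) \<longlonglongrightarrow> 0"
  proof (rule tendsto_sandwich[OF _ _ tendsto_const])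
    have eq: "(\<lambda>x. h x - ?c (cs n) x) = (\<lambda>x. h x + ?c (scale_combo (-1) (cs n)) x)" for n
      by (simp add: zero_ext_def fun_eq_iff)
    have "norm_sq (\<lambda>x. ?c (cs n) x - h x) = norm_sq h - energy h (cs n)" for n
      using cs[of n] unfolding norm_sq_minus[OF native_space_comb[OF cs] h] eq
      by (subst norm_sq_add_comb[OF h]) (auto simp: energy_def sq_norm_scale_combo)
    then show "\<forall>\<^sub>F n in sequentially. sqrt (norm_sq (\<lambda>x. ?c (cs n) x - h x)) \<le> sqrt (1 / Suc n)"
      using en by (intro always_eventually allI real_sqrt_le_mono) (smt (verit, best))
    show "(\<lambda>n. sqrt (1 / Suc n)) \<longlonglongrightarrow> 0"
      using tendsto_real_sqrt[OF LIMSEQ_inverse_real_of_nat] by (simp add: inverse_eq_divide)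
  qed (use norm_sq_nonneg[OF native_space_diff[OF native_space_comb[OF cs] h]] in auto)
  have "h = h'"
  proof
    fix x show "h x = h' x"
      by (rule LIMSEQ_unique[OF norm_tendsto_0_pointwise[OF native_space_comb[OF cs] h lim2]
          norm_tendsto_0_pointwise[OF native_space_comb[OF cs] h's lim']])
  qed
  then show "h \<in> H" using h' by simp
qed

theorem rkhs_eq_native_space: "rkhs X k = native_space"
  unfolding rkhs_def
proof (rule the_equality)
  show "\<exists>ip. is_rkhs X k native_space ip" using is_rkhs_native_space by blast
  show "H = native_space" if "\<exists>ip. is_rkhs X k H ip" for H
    using that rkhs_subset_native_space(1) native_space_subset_rkhs by blast
qed

section \<open>Multipliers separate points no better than the kernel\<close>

text \<open>
  The sets on which the norm of \<open>\<Phi> h\<close> is at most \<open>sqrt n\<close> cover the space, and they are closed because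
  the norm is lower semicontinuous under pointwise convergence. By the Baire category theorem one of
  them contains a ball, so multiplication by \<open>\<Phi>\<close> is bounded near 0.
\<close>
theorem multiplier_bounded:
  assumes \<Phi>: "\<Phi> \<in> Mult X native_space"
  shows "\<exists>C\<ge>0. \<forall>h\<in>native_space. norm_sq (\<lambda>x. \<Phi> x * h x) \<le> C * norm_sq h"
proof -
  (* the value off the space makes d a symmetric function on the whole type *)
  define d where "d h u = (if h \<in> native_space \<and> u \<in> native_space then sqrt (norm_sq (\<lambda>x. h x - u x)) else 0)" for h u
  have mult: "(\<lambda>x. \<Phi> x * h x) \<in> native_space" if "h \<in> native_space" for h
    using \<Phi> that by (auto simp: Mult_def)
  interpret M: Metric_space native_space d
  proof
    show "0 \<le> d x y" for x y by (auto simp: d_def intro: norm_sq_nonneg native_space_diff)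
    show "d x y = d y x" for x y using norm_sq_minus[of x y] by (auto simp: d_def)
    show "(d x y = 0) = (x = y)" if "x \<in> native_space" "y \<in> native_space" for x y
      using norm_sq_eq_0[OF native_space_diff[OF that]] norm_sq_scale[OF native_space_zero, of 0] that
      by (auto simp: d_def fun_eq_iff)
    show "d x z \<le> d x y + d y z" if "x \<in> native_space" "y \<in> native_space" "z \<in> native_space" for x y z
      using norm_triangle[OF native_space_diff[of x y] native_space_diff[of y z]] that by (simp add: d_def)
  qed
  have lim_iff: "(\<lambda>n. sqrt (norm_sq (\<lambda>x. s n x - h x))) \<longlonglongrightarrow> 0"
    if l: "limitin M.mtopology s h sequentially" and s: "\<And>n. s n \<in> native_space" for s h
  proof (rule LIMSEQ_I)
    fix r :: real assume "0 < r"
    then obtain N where N: "\<forall>n\<ge>N. s n \<in> native_space \<and> d (s n) h < r"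
      using l by (auto simp: M.limit_metric_sequentially)
    moreover have "h \<in> native_space" using l by (auto simp: M.limit_metric_sequentially)
    ultimately show "\<exists>no. \<forall>n\<ge>no. norm (sqrt (norm_sq (\<lambda>x. s n x - h x)) - 0) < r"
      using norm_sq_nonneg[OF native_space_diff] by (intro exI[of _ N]) (auto simp: d_def)
  qed
  have complete: "M.mcomplete"
    unfolding M.mcomplete_def
  proof (intro allI impI)
    fix s assume "M.MCauchy s"
    then have s: "\<And>n. s n \<in> native_space" and c: "\<forall>e>0. \<exists>N. \<forall>m\<ge>N. \<forall>n\<ge>N. d (s m) (s n) < e"
      by (auto simp: M.MCauchy_def)
    obtain h where h: "h \<in> native_space" and l: "(\<lambda>n. sqrt (norm_sq (\<lambda>x. s n x - h x))) \<longlonglongrightarrow> 0"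
      using native_space_complete[of s] s c by (auto simp: d_def)
    have "\<exists>N. \<forall>n\<ge>N. s n \<in> native_space \<and> d (s n) h < e" if "e > 0" for e
    proof -
      obtain N where "\<forall>n\<ge>N. norm (sqrt (norm_sq (\<lambda>x. s n x - h x)) - 0) < e"
        using LIMSEQ_D[OF l \<open>e > 0\<close>] by blast
      then show ?thesis
        using s h by (intro exI[of _ N]) (auto simp: d_def intro: le_less_trans[OF abs_ge_self])
    qed
    then show "\<exists>h. limitin M.mtopology s h sequentially"
      using h by (auto simp: M.limit_metric_sequentially)
  qed
  define S where "S n = {h \<in> native_space. norm_sq (\<lambda>x. \<Phi> x * h x) \<le> real n}" for n
  have closed: "closedin M.mtopology (S n)" for n
    unfolding M.metric_closedin_iff_sequentially_closed
  proof (intro conjI allI impI)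
    fix s h assume "range s \<subseteq> S n \<and> limitin M.mtopology s h sequentially"
    then have s: "\<And>m. s m \<in> S n" and l: "limitin M.mtopology s h sequentially" by auto
    have s': "\<And>m. s m \<in> native_space" using s by (simp add: S_def)
    have h: "h \<in> native_space" using l by (auto simp: M.limit_metric_sequentially)
    have pt: "(\<lambda>m. \<Phi> x * s m x) \<longlonglongrightarrow> \<Phi> x * h x" for x
      by (intro tendsto_intros norm_tendsto_0_pointwise[OF s' h lim_iff[OF l s']])
    have "norm_sq (\<lambda>x. \<Phi> x * h x) \<le> n"
    proof (rule norm_sq_le)
      fix cs assume cs: "cs \<in> combos X"
      have "(\<lambda>m. energy (\<lambda>x. \<Phi> x * s m x) cs) \<longlonglongrightarrow> energy (\<lambda>x. \<Phi> x * h x) cs"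
        unfolding energy_def by (intro tendsto_intros pairing_tendsto[OF _ cs] pt)
      then show "energy (\<lambda>x. \<Phi> x * h x) cs \<le> n"
      proof (rule LIMSEQ_le_const2)
        show "\<exists>N. \<forall>m\<ge>N. energy (\<lambda>x. \<Phi> x * s m x) cs \<le> n"
          using energy_le[OF mult[OF s'] cs] s by (auto simp: S_def intro: order_trans)
      qed
    qed
    then show "h \<in> S n" using h by (simp add: S_def)
  qed (auto simp: S_def)
  have "\<Union>(range S) = native_space"
    by (auto simp: S_def intro: real_arch_simple)
  then have "M.mtopology interior_of \<Union>(range S) \<noteq> {}"
    using native_space_zero interior_of_topspace[of M.mtopology] by auto
  then obtain n where "M.mtopology interior_of S n \<noteq> {}"
    using M.metric_Baire_category_alt[OF complete, of "range S"] closed by auto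
  then obtain h0 r where h0: "h0 \<in> native_space" and r: "r > 0" and ball: "M.mball h0 r \<subseteq> S n"
    using interior_of_subset[of M.mtopology "S n"] openin_interior_of[of M.mtopology "S n"]
    unfolding M.openin_mtopology by (metis ex_in_conv order_trans subsetD)
  have small: "norm_sq (\<lambda>x. \<Phi> x * u x) \<le> 4 * n" if u: "u \<in> native_space" and "sqrt (norm_sq u) < r" for u
  proof -
    have "(\<lambda>x. h0 x + u x) \<in> M.mball h0 r"
      using that h0 norm_sq_minus[OF h0 native_space_add[OF h0 u]]
      by (simp add: native_space_add d_def)
    then have 1: "norm_sq (\<lambda>x. \<Phi> x * (h0 x + u x)) \<le> n" using ball by (auto simp: S_def)
    have 2: "norm_sq (\<lambda>x. \<Phi> x * h0 x) \<le> n"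
      using ball M.centre_in_mball_iff h0 r by (auto simp: S_def)
    have "norm_sq (\<lambda>x. \<Phi> x * (h0 x + u x) + \<Phi> x * h0 x) + norm_sq (\<lambda>x. \<Phi> x * (h0 x + u x) - \<Phi> x * h0 x)
        \<le> 2 * norm_sq (\<lambda>x. \<Phi> x * (h0 x + u x)) + 2 * norm_sq (\<lambda>x. \<Phi> x * h0 x)"
      by (intro parallelogram_le mult native_space_add h0 u)
    moreover have "0 \<le> norm_sq (\<lambda>x. \<Phi> x * (h0 x + u x) + \<Phi> x * h0 x)"
      by (intro norm_sq_nonneg native_space_add mult h0 u)
    ultimately show ?thesis using 1 2 by (simp add: algebra_simps)
  qed
  have "norm_sq (\<lambda>x. \<Phi> x * h x) \<le> (4 * n * 4 / r\<^sup>2) * norm_sq h" if h: "h \<in> native_space" for h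
  proof (cases "norm_sq h = 0")
    case True
    then have "h = (\<lambda>x. 0)" using norm_sq_eq_0[OF h] by simp
    then show ?thesis using True by simp
  next
    case False
    then have pos: "norm_sq h > 0" using norm_sq_nonneg[OF h] by simp
    (* scales h to norm r / 2 *)
    define t where "t = r / (2 * sqrt (norm_sq h))"
    have t: "t > 0" "t\<^sup>2 * norm_sq h = r\<^sup>2 / 4" using pos r by (simp_all add: t_def power_divide power_mult_distrib)
    have "sqrt (norm_sq (\<lambda>x. of_real t * h x)) = r / 2"
    proof -
      have "norm_sq (\<lambda>x. of_real t * h x) = (r / 2)\<^sup>2"
        using t by (simp add: norm_sq_scale[OF h] power_divide)
      then show ?thesis using r by simp
    qed
    then have "norm_sq (\<lambda>x. \<Phi> x * (of_real t * h x)) \<le> 4 * n"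
      using r by (intro small native_space_scale h) simp
    also have "(\<lambda>x. \<Phi> x * (of_real t * h x)) = (\<lambda>x. of_real t * (\<Phi> x * h x))"
      by (simp add: fun_eq_iff)
    finally have "t\<^sup>2 * norm_sq (\<lambda>x. \<Phi> x * h x) \<le> 4 * n" by (simp add: norm_sq_scale mult h)
    moreover have "t\<^sup>2 = r\<^sup>2 / (4 * norm_sq h)" using t pos by (simp add: field_simps)
    ultimately show ?thesis using pos r by (simp add: field_simps)
  qed
  then show ?thesis using r by (intro exI[of _ "4 * n * 4 / r\<^sup>2"]) auto
qed

text \<open>
  With \<open>h\<close> the kernel function at \<open>z\<close>, the functional that sends \<open>u\<close> to
  \<open>u z / k z z - u w / k w z\<close> takes the value \<open>\<Phi> z - \<Phi> w\<close> at \<open>\<Phi> h\<close>. Its squared norm is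
  \<open>k w w / |k z w|^2 - 1 / k z z\<close>, while \<open>h\<close> has squared norm \<open>k z z\<close>.
\<close>
theorem multiplier_oscillation:
  assumes "\<Phi> \<in> Mult X native_space"
  shows "\<exists>C. \<forall>z\<in>X. \<forall>w\<in>X. k z w \<noteq> 0 \<longrightarrow> k z z \<noteq> 0 \<longrightarrow>
    (cmod (\<Phi> z - \<Phi> w))\<^sup>2 \<le> C * (Re (k z z) * Re (k w w) / (cmod (k z w))\<^sup>2 - 1)"
proof -
  obtain C where C: "C \<ge> 0" and bd: "\<And>h. h \<in> native_space \<Longrightarrow> norm_sq (\<lambda>x. \<Phi> x * h x) \<le> C * norm_sq h"
    using multiplier_bounded[OF assms] by blast
  have mult: "(\<lambda>x. \<Phi> x * h x) \<in> native_space" if "h \<in> native_space" for h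
    using assms that by (auto simp: Mult_def)
  have "(cmod (\<Phi> z - \<Phi> w))\<^sup>2 \<le> C * (Re (k z z) * Re (k w w) / (cmod (k z w))\<^sup>2 - 1)"
    if z: "z \<in> X" and w: "w \<in> X" and nz: "k z w \<noteq> 0" "k z z \<noteq> 0" for z w
  proof -
    define p where "p = Re (k z z)"
    have real: "k x x = of_real (Re (k x x))" if "x \<in> X" for x
      using herm[OF that that] by (simp add: complex_eq_iff)
    have p: "p > 0" and kzz: "k z z = of_real p"
      using psd[of "[(1, z)]"] z nz real[OF z] by (auto simp: sq_norm_def p_def less_le)
    let ?b = "- 1 / k z w"
    let ?cs = "[(of_real (1 / p), z), (?b, w)]"
    have cs: "?cs \<in> combos X" using z w by simp
    let ?h = "zero_ext X (comb k [(1, z)])"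
    have h: "?h \<in> native_space" using native_space_comb[of "[(1, z)]"] z by simp
    have kwz: "k w z = cnj (k z w)" by (rule herm[OF z w])
    have 1: "pairing (\<lambda>x. \<Phi> x * ?h x) ?cs = \<Phi> z - \<Phi> w"
      using z w p nz by (simp add: zero_ext_def kzz kwz)
    have "sq_norm k ?cs = Re (k w w) / (cmod (k z w))\<^sup>2 - 1 / p"
    proof -
      have "cnj ?b * (?b * k w w) = of_real (Re (k w w) / (cmod (k z w))\<^sup>2)"
        by (subst real[OF w]) (simp add: complex_norm_square mult.commute del: of_real_power)
      then show ?thesis
        using p nz unfolding sq_norm_def
        by (simp add: kzz kwz algebra_simps)
    qed
    then have 2: "sq_norm k ?cs = (p * Re (k w w) / (cmod (k z w))\<^sup>2 - 1) / p"
      using p by (simp add: field_simps)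
    have "(cmod (\<Phi> z - \<Phi> w))\<^sup>2 \<le> norm_sq (\<lambda>x. \<Phi> x * ?h x) * sq_norm k ?cs"
      using pairing_bound[OF mult[OF h] cs] by (simp only: 1)
    also have "\<dots> \<le> (C * norm_sq ?h) * sq_norm k ?cs"
      by (intro mult_right_mono bd h psd cs)
    also have "norm_sq ?h = p"
      using norm_sq_comb[of "[(1, z)]"] z by (simp add: sq_norm_def p_def)
    finally show ?thesis using p unfolding 2 by (simp add: p_def)
  qed
  then show ?thesis by blast
qed

end

section \<open>The Drury-Arveson kernel\<close>

lemma comb_cong:
  assumes "\<And>x. x \<in> X \<Longrightarrow> k y x = k' y x" "cs \<in> combos X"
  shows "comb k cs y = comb k' cs y"
  using assms(2) by (induction cs) (auto simp: assms(1))

lemma pairing_cong: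
  assumes "\<And>x. x \<in> X \<Longrightarrow> h x = h' x" "cs \<in> combos X"
  shows "pairing h cs = pairing h' cs"
  using assms(2) by (induction cs) (auto simp: assms(1))

lemma sq_norm_cong:
  assumes "\<And>x y. x \<in> X \<Longrightarrow> y \<in> X \<Longrightarrow> k y x = k' y x" "cs \<in> combos X"
  shows "sq_norm k cs = sq_norm k' cs"
  unfolding sq_norm_def using assms
  by (intro arg_cong[where f = Re] pairing_cong[where X = X] comb_cong[where X = X]) auto

lemma sq_norm_kernel_add: "sq_norm (\<lambda>y x. k y x + k' y x) cs = sq_norm k cs + sq_norm k' cs"
proof -
  have "comb (\<lambda>y x. k y x + k' y x) cs = (\<lambda>y. comb k cs y + comb k' cs y)"
    by (induction cs) (auto simp: algebra_simps)
  then show ?thesis by (simp add: sq_norm_def pairing_fun_add)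
qed

lemma comb_tendsto:
  assumes "\<And>x. x \<in> X \<Longrightarrow> (\<lambda>n. K n y x) \<longlonglongrightarrow> k y x" "cs \<in> combos X"
  shows "(\<lambda>n. comb (K n) cs y) \<longlonglongrightarrow> comb k cs y"
  using assms(2) by (induction cs) (auto intro!: tendsto_intros assms(1))

lemma psd_kernel_limit:
  assumes K: "\<And>n. psd_kernel X (K n)"
    and lim: "\<And>x y. x \<in> X \<Longrightarrow> y \<in> X \<Longrightarrow> (\<lambda>n. K n y x) \<longlonglongrightarrow> k y x"
  shows "psd_kernel X k"
proof
  fix x y assume xy: "x \<in> X" "y \<in> X"
  have "(\<lambda>n. K n y x) \<longlonglongrightarrow> cnj (k x y)"
    using tendsto_cnj[OF lim[OF xy(2,1)]] psd_kernel.herm[OF K xy] by simp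
  then show "k y x = cnj (k x y)" using LIMSEQ_unique lim[OF xy] by blast
next
  fix cs assume cs: "cs \<in> combos X"
  have "(\<lambda>n. sq_norm (K n) cs) \<longlonglongrightarrow> sq_norm k cs"
    unfolding sq_norm_def
    by (intro tendsto_intros pairing_tendsto[OF _ cs] comb_tendsto[OF _ cs] lim)
  then show "0 \<le> sq_norm k cs"
    by (rule LIMSEQ_le_const) (auto intro: psd_kernel.psd[OF K cs])
qed

lemma psd_kernel_one: "psd_kernel X (\<lambda>y x. 1)"
proof
  fix cs :: "(complex \<times> 'a) list"
  define s where "s = comb (\<lambda>y x. 1) cs (undefined :: 'a)"
  have 1: "comb (\<lambda>y x. 1) cs = (\<lambda>y::'a. s)" by (auto simp: s_def comb_def)
  have "pairing (\<lambda>y. 1) cs = cnj s"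
    unfolding s_def by (induction cs) auto
  then have "pairing (\<lambda>y. s) cs = s * cnj s" using pairing_fun_scale[of s "\<lambda>y. 1" cs] by simp
  then show "0 \<le> sq_norm (\<lambda>y x. 1) cs" by (simp add: sq_norm_def 1 flip: complex_norm_square of_real_power)
qed simp

lemma psd_kernel_add:
  assumes "psd_kernel X k" "psd_kernel X k'"
  shows "psd_kernel X (\<lambda>y x. k y x + k' y x)"
proof -
  interpret k: psd_kernel X k by fact
  interpret k': psd_kernel X k' by fact
  show ?thesis
  proof
    show "k y x + k' y x = cnj (k x y + k' x y)" if "x \<in> X" "y \<in> X" for x y
      by (simp only: k.herm[OF that] k'.herm[OF that] complex_cnj_add)
  qed (simp add: sq_norm_kernel_add k.psd k'.psd)
qed

lemma psd_kernel_sum: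
  fixes X :: "'x set"
  assumes "finite I" "\<And>i. i \<in> I \<Longrightarrow> psd_kernel X (K i)"
  shows "psd_kernel X (\<lambda>y x. \<Sum>i\<in>I. K i y x)"
  using assms
proof (induction I)
  case empty
  have "comb (\<lambda>y x. 0) cs = (\<lambda>y::'x. 0)" for cs by (induction cs) auto
  then show ?case by unfold_locales (auto simp: sq_norm_def)
next
  case (insert i I)
  then show ?case using psd_kernel_add[of X "K i" "\<lambda>y x. \<Sum>i\<in>I. K i y x"] by simp
qed

text \<open>
  The adjoint of multiplication by \<open>u\<close>, which multiplies the kernel function at \<open>x\<close> by \<open>cnj (u x)\<close>.
\<close>
definition twist :: "('a \<Rightarrow> complex) \<Rightarrow> (complex \<times> 'a) list \<Rightarrow> (complex \<times> 'a) list" where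
  "twist u cs = map (\<lambda>(c, x). (c * cnj (u x), x)) cs"

lemma twist_combos [simp]: "twist u cs \<in> combos X \<longleftrightarrow> cs \<in> combos X"
  by (auto simp: combos_def twist_def case_prod_unfold image_image)

lemma pairing_twist: "pairing h (twist u cs) = pairing (\<lambda>x. u x * h x) cs"
  by (induction cs) (auto simp: twist_def)

lemma sq_norm_twist: "sq_norm k (twist u cs) = sq_norm (\<lambda>y x. u y * k y x * cnj (u x)) cs"
proof -
  have "comb (\<lambda>y x. u y * k y x * cnj (u x)) cs = (\<lambda>y. u y * comb k (twist u cs) y)"
    by (induction cs) (auto simp: twist_def algebra_simps)
  then show ?thesis by (simp add: sq_norm_def pairing_twist)
qed

lemma psd_kernel_conjugate:
  assumes "psd_kernel X k"
  shows "psd_kernel X (\<lambda>y x. u y * k y x * cnj (u x))"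
proof -
  interpret k: psd_kernel X k by fact
  show ?thesis
  proof
    show "0 \<le> sq_norm (\<lambda>y x. u y * k y x * cnj (u x)) cs" if "cs \<in> combos X" for cs
      using k.psd[of "twist u cs"] that by (simp add: sq_norm_twist)
    show "u y * k y x * cnj (u x) = cnj (u x * k x y * cnj (u y))" if "x \<in> X" "y \<in> X" for x y
      by (simp add: k.herm[OF that])
  qed
qed

lemma norm_cinner_le: "cmod (cinner z w) \<le> norm z * norm w"
proof -
  have "cmod (cinner z w) \<le> (\<Sum>j\<in>UNIV. \<bar>cmod (z $ j)\<bar> * \<bar>cmod (w $ j)\<bar>)"
    unfolding cinner_def by (rule order_trans[OF norm_sum]) (simp add: norm_mult)
  also have "\<dots> \<le> norm z * norm w"
    unfolding norm_vec_def by (rule L2_set_mult_ineq)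
  finally show ?thesis .
qed

lemma cinner_self: "cinner z z = of_real ((norm z)\<^sup>2)"
proof -
  have "(norm z)\<^sup>2 = (\<Sum>j\<in>UNIV. (cmod (z $ j))\<^sup>2)"
    unfolding norm_vec_def L2_set_def by (simp add: sum_nonneg)
  then show ?thesis by (simp add: cinner_def complex_norm_square del: of_real_power)
qed

abbreviation DA_kernel :: "complex ^ 'd \<Rightarrow> complex ^ 'd \<Rightarrow> complex" where
  "DA_kernel z w \<equiv> 1 / (1 - cinner z w)"

lemma norm_cinner_less_1: "z \<in> ball 0 1 \<Longrightarrow> w \<in> ball 0 1 \<Longrightarrow> cmod (cinner z w) < 1"
  using norm_cinner_le[of z w] mult_strict_mono[of "norm z" 1 "norm w" 1] by simp

text \<open>
  The step writes one factor \<open>cinner z w\<close> as the sum over \<open>j\<close> of \<open>z $ j * cnj (w $ j)\<close>, so that the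
  new kernel is a sum of conjugates of the old one.
\<close>
lemma psd_kernel_cinner_power: "psd_kernel X (\<lambda>z w. cinner z w ^ n)"
proof (induction n)
  case 0
  then show ?case by (simp add: psd_kernel_one)
next
  case (Suc n)
  have "(\<lambda>z w :: complex ^ 'a. cinner z w ^ Suc n)
      = (\<lambda>z w. \<Sum>j\<in>UNIV. z $ j * cinner z w ^ n * cnj (w $ j))"
    by (simp add: fun_eq_iff cinner_def sum_distrib_right mult_ac)
  then show ?case using Suc by (simp only:) (intro psd_kernel_sum psd_kernel_conjugate, auto)
qed

lemma psd_DA_kernel: "psd_kernel (ball 0 1) (DA_kernel :: complex ^ 'd \<Rightarrow> _)"
proof (rule psd_kernel_limit)
  show "psd_kernel (ball 0 1) (\<lambda>z w :: complex ^ 'd. \<Sum>i<n. cinner z w ^ i)" for n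
    by (intro psd_kernel_sum psd_kernel_cinner_power) simp
  show "(\<lambda>n. \<Sum>i<n. cinner z w ^ i) \<longlonglongrightarrow> DA_kernel z w"
    if "w \<in> ball 0 1" "z \<in> ball 0 1" for z w :: "complex ^ 'd"
    using geometric_sums[OF norm_cinner_less_1[OF that(2,1)]] by (simp add: sums_def)
qed

global_interpretation DA: psd_kernel "ball 0 1 :: (complex ^ 'd) set" DA_kernel
  by (rule psd_DA_kernel)

lemma DA_mult_eq: "DA_mult = Mult (ball 0 1) (DA.native_space :: (complex ^ 'd \<Rightarrow> complex) set)"
  unfolding DA_mult_def drury_arveson_def DA.rkhs_eq_native_space ..

text \<open>
  Multiplication by a coordinate is a contraction. Indeed \<open>(1 - \<langle>z,w\<rangle>) k = 1\<close> for the kernel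
  \<open>k = DA_kernel z w\<close>, so that
  \<open>k - z $ j * k * cnj (w $ j) = 1 + (\<Sum>l\<in>UNIV - {j}. z $ l * k * cnj (w $ l))\<close>,
  where the right-hand side is visibly positive semidefinite.
\<close>
lemma sq_norm_twist_coordinate_le:
  fixes cs :: "(complex \<times> (complex ^ 'd)) list"
  assumes cs: "cs \<in> combos (ball 0 1)"
  shows "sq_norm DA_kernel (twist (\<lambda>z. z $ j) cs) \<le> sq_norm DA_kernel cs"
proof -
  let ?K = "\<lambda>z w :: complex ^ 'd. 1 + (\<Sum>l\<in>UNIV - {j}. z $ l * DA_kernel z w * cnj (w $ l))"
  have "psd_kernel (ball 0 1) ?K"
    by (intro psd_kernel_add psd_kernel_one psd_kernel_sum psd_kernel_conjugate psd_DA_kernel) simp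
  then have pos: "0 \<le> sq_norm ?K cs" using psd_kernel.psd cs by blast
  have "?K z w + z $ j * DA_kernel z w * cnj (w $ j) = DA_kernel z w"
    if "z \<in> ball 0 1" "w \<in> ball 0 1" for z w
  proof -
    have nz: "1 - cinner z w \<noteq> 0" using norm_cinner_less_1[OF that] by auto
    have "?K z w + z $ j * DA_kernel z w * cnj (w $ j)
        = 1 + (\<Sum>l\<in>UNIV. z $ l * DA_kernel z w * cnj (w $ l))"
      by (simp add: sum.remove[of UNIV j])
    also have "(\<Sum>l\<in>UNIV. z $ l * DA_kernel z w * cnj (w $ l)) = cinner z w * DA_kernel z w"
      unfolding cinner_def[of z w] sum_distrib_right by (intro sum.cong) (auto simp: mult_ac)
    finally show ?thesis using nz by (simp add: field_simps)
  qed
  then have "sq_norm DA_kernel cs = sq_norm (\<lambda>z w. ?K z w + z $ j * DA_kernel z w * cnj (w $ j)) cs"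
    using cs by (intro sq_norm_cong[where X = "ball 0 1"]) auto
  also have "\<dots> = sq_norm ?K cs + sq_norm DA_kernel (twist (\<lambda>z. z $ j) cs)"
    unfolding sq_norm_twist by (rule sq_norm_kernel_add)
  finally show ?thesis using pos by simp
qed

theorem coordinate_multiplier: "zero_ext (ball 0 1) (\<lambda>z :: complex ^ 'd. z $ j) \<in> DA_mult"
  unfolding DA_mult_eq Mult_def
proof safe
  show "zero_ext (ball 0 1) (\<lambda>z :: complex ^ 'd. z $ j) \<in> fun_on (ball 0 1)"
    by (simp add: fun_on_def zero_ext_def)
  fix h :: "complex ^ 'd \<Rightarrow> complex" assume h: "h \<in> DA.native_space"
  have eq: "(\<lambda>x. zero_ext (ball 0 1) (\<lambda>z. z $ j) x * h x) = (\<lambda>x. x $ j * h x)"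
    using DA.native_space_off[OF h] by (auto simp: zero_ext_def fun_eq_iff)
  show "(\<lambda>x. zero_ext (ball 0 1) (\<lambda>z. z $ j) x * h x) \<in> DA.native_space"
    unfolding eq
  proof (rule DA.native_spaceI)
    show "(\<lambda>x. x $ j * h x) \<in> fun_on (ball 0 1)"
      using DA.native_space_off[OF h] by (simp add: fun_on_def)
    fix cs :: "(complex \<times> (complex ^ 'd)) list" assume cs: "cs \<in> combos (ball 0 1)"
    have "DA.energy (\<lambda>x. x $ j * h x) cs \<le> DA.energy h (twist (\<lambda>z. z $ j) cs)"
      using sq_norm_twist_coordinate_le[OF cs, of j] by (simp add: DA.energy_def pairing_twist)
    also have "\<dots> \<le> DA.norm_sq h" using cs by (intro DA.energy_le h) simp
    finally show "DA.energy (\<lambda>x. x $ j * h x) cs \<le> DA.norm_sq h" .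
  qed
qed

theorem DA_mult_oscillation:
  fixes \<Phi> :: "complex ^ 'd \<Rightarrow> complex"
  assumes "\<Phi> \<in> DA_mult"
  shows "\<exists>C. \<forall>z\<in>ball 0 1. \<forall>w\<in>ball 0 1. (cmod (\<Phi> z - \<Phi> w))\<^sup>2
    \<le> C * ((cmod (1 - cinner z w))\<^sup>2 / (cmod (1 - cinner z z) * cmod (1 - cinner w w)) - 1)"
proof -
  obtain C where C: "\<And>z w. z \<in> ball 0 1 \<Longrightarrow> w \<in> ball 0 1 \<Longrightarrow>
      DA_kernel z w \<noteq> 0 \<Longrightarrow> DA_kernel z z \<noteq> 0 \<Longrightarrow> (cmod (\<Phi> z - \<Phi> w))\<^sup>2
      \<le> C * (Re (DA_kernel z z) * Re (DA_kernel w w) / (cmod (DA_kernel z w))\<^sup>2 - 1)"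
    using DA.multiplier_oscillation[OF assms[unfolded DA_mult_eq]] by blast
  have nz: "1 - cinner z w \<noteq> 0" if "z \<in> ball 0 1" "w \<in> ball 0 1" for z w :: "complex ^ 'd"
    using norm_cinner_less_1[OF that] by auto
  have diag: "Re (DA_kernel z z) = 1 / cmod (1 - cinner z z)" if "z \<in> ball 0 1" for z :: "complex ^ 'd"
  proof -
    have "(norm z)\<^sup>2 < 1" using that by (simp add: power_less_one_iff abs_square_less_1)
    moreover have "1 - cinner z z = of_real (1 - (norm z)\<^sup>2)" by (simp add: cinner_self)
    ultimately show ?thesis
      by (simp only: norm_of_real Re_divide_of_real) simp
  qed
  have "(cmod (\<Phi> z - \<Phi> w))\<^sup>2
      \<le> C * ((cmod (1 - cinner z w))\<^sup>2 / (cmod (1 - cinner z z) * cmod (1 - cinner w w)) - 1)"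
    if z: "z \<in> ball 0 1" and w: "w \<in> ball 0 1" for z w
    using C[OF z w] nz[OF z w] nz[OF z z]
    unfolding diag[OF z] diag[OF w] norm_divide power_divide by simp
  then show ?thesis by blast
qed

section \<open>Boundary behaviour of attached discs\<close>

lemma has_vector_derivative_quotient:
  fixes h :: "real \<Rightarrow> complex"
  assumes "(h has_vector_derivative D) (at 0 within S)"
  shows "((\<lambda>t. (h t - h 0) / of_real t) \<longlongrightarrow> D) (at 0 within S)"
proof -
  have "((\<lambda>t. norm ((h t - h 0) / of_real t - D)) \<longlongrightarrow> 0) (at 0 within S)"
  proof (rule Lim_transform_eventually)
    show "((\<lambda>t. norm (h t - h 0 - t *\<^sub>R D) / norm t) \<longlongrightarrow> 0) (at 0 within S)"
      using assms
      by (simp add: has_vector_derivative_def has_derivative_iff_norm)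
    have "norm (h t - h 0 - t *\<^sub>R D) / norm t = norm ((h t - h 0) / of_real t - D)" if "t \<noteq> 0" for t
    proof -
      have "(h t - h 0) / of_real t - D = (h t - h 0 - t *\<^sub>R D) / of_real t"
        using that by (simp add: field_simps scaleR_conv_of_real)
      then show ?thesis by (simp add: norm_divide)
    qed
    then show "\<forall>\<^sub>F t in at 0 within S. norm (h t - h 0 - t *\<^sub>R D) / norm t
        = norm ((h t - h 0) / of_real t - D)"
      by (auto simp: eventually_at intro!: exI[of _ 1])
  qed
  then show ?thesis by (simp add: LIM_zero_cancel tendsto_norm_zero_iff)
qed

text \<open>
  The derivative is complex linear in the open disc, and this identity persists on the closure by
  continuity of the derivative.
\<close>
lemma cauchy_riemann_up_to_boundary:
  fixes \<phi> :: "complex \<Rightarrow> complex" and D :: "complex \<Rightarrow> complex \<Rightarrow> complex"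
  assumes hol: "\<phi> holomorphic_on ball 0 1"
    and der: "\<And>x. x \<in> cball 0 1 \<Longrightarrow> (\<phi> has_derivative D x) (at x within cball 0 1)"
    and cont: "\<And>v. continuous_on (cball 0 1) (\<lambda>x. D x v)"
    and x: "x \<in> cball 0 1"
  shows "D x (\<i> * v) = \<i> * D x v"
proof -
  have "D x (\<i> * v) - \<i> * D x v = 0"
  proof (rule continuous_constant_on_closure[of "ball 0 1" "\<lambda>x. D x (\<i> * v) - \<i> * D x v"])
    show "continuous_on (closure (ball 0 1)) (\<lambda>x. D x (\<i> * v) - \<i> * D x v)"
      by (simp, intro continuous_intros cont)
    show "x \<in> closure (ball 0 1)" using x by simp
    fix y :: complex assume y: "y \<in> ball 0 1"
    have "(\<phi> has_derivative (*) (deriv \<phi> y)) (at y)"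
      using holomorphic_derivI[OF hol open_ball y] by (simp add: has_field_derivative_def)
    moreover have "(\<phi> has_derivative D y) (at y)"
      using der[of y] y at_within_interior[of y "cball 0 1"] by simp
    ultimately have "D y = (*) (deriv \<phi> y)" by (metis has_derivative_unique)
    then show "D y (\<i> * v) - \<i> * D y v = 0" by simp
  qed
  then show ?thesis by simp
qed

text \<open>
  A quantitative form of the Hopf lemma. On the circle of radius \<open>1/2\<close> the modulus of \<open>\<phi>\<close> is bounded
  by some \<open>s < 1\<close>, so for large \<open>N\<close> the function \<open>\<phi> z ^ N / z\<close> has modulus at most 1 on both boundary
  circles of the annulus, and the maximum principle applies.
\<close>
lemma power_le_norm_on_annulus:
  fixes \<phi> :: "complex \<Rightarrow> complex"
  assumes hol: "\<phi> holomorphic_on ball 0 1" and cont: "continuous_on (cball 0 1) \<phi>"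
    and le: "\<And>z. z \<in> cball 0 1 \<Longrightarrow> cmod (\<phi> z) \<le> 1"
    and less: "\<And>z. z \<in> ball 0 1 \<Longrightarrow> cmod (\<phi> z) < 1"
  shows "\<exists>N>0. \<forall>z. 1/2 < cmod z \<and> cmod z < 1 \<longrightarrow> cmod (\<phi> z) ^ N \<le> cmod z"
proof -
  have "compact (sphere (0::complex) (1/2))" "sphere (0::complex) (1/2) \<noteq> {}" by auto
  moreover have "continuous_on (sphere 0 (1/2)) (\<lambda>z. cmod (\<phi> z))"
    by (intro continuous_intros continuous_on_subset[OF cont]) auto
  ultimately obtain z0 where z0: "z0 \<in> sphere 0 (1/2)"
    and max: "\<And>z. z \<in> sphere 0 (1/2) \<Longrightarrow> cmod (\<phi> z) \<le> cmod (\<phi> z0)"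
    using continuous_attains_sup by metis
  have "cmod (\<phi> z0) < 1" using z0 by (intro less) auto
  then obtain M where M: "cmod (\<phi> z0) ^ M < 1/2"
    using real_arch_pow_inv[of "1/2"] by auto
  have M0: "M > 0" using M by (cases M) auto
  define S where "S = ball (0::complex) 1 - cball 0 (1/2)"
  have S: "open S" by (auto simp: S_def)
  have clS: "closure S \<subseteq> cball 0 1 - ball 0 (1/2)"
    by (rule closure_minimal) (auto simp: S_def closed_Diff)
  have frS: "frontier S \<subseteq> sphere 0 1 \<union> sphere 0 (1/2)"
  proof
    fix z assume "z \<in> frontier S"
    then have "z \<in> closure S" "z \<notin> S" using S by (auto simp: frontier_def interior_open)
    then show "z \<in> sphere 0 1 \<union> sphere 0 (1/2)" using clS by (auto simp: S_def)
  qed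
  have "cmod (\<phi> z ^ M / z) \<le> 1" if z: "z \<in> S" for z
  proof (rule maximum_modulus_frontier[OF _ _ _ _ z])
    show "(\<lambda>z. \<phi> z ^ M / z) holomorphic_on interior S"
      unfolding interior_open[OF S]
      by (intro holomorphic_intros holomorphic_on_subset[OF hol]) (auto simp: S_def)
    show "continuous_on (closure S) (\<lambda>z. \<phi> z ^ M / z)"
      using clS by (intro continuous_intros continuous_on_subset[OF cont]) auto
    show "bounded S" by (auto simp: S_def intro: bounded_subset[OF bounded_ball])
    fix z assume "z \<in> frontier S"
    then consider "cmod z = 1" | "cmod z = 1/2" using frS by auto
    then show "cmod (\<phi> z ^ M / z) \<le> 1"
    proof cases
      case 1
      then show ?thesis using le[of z] by (simp add: norm_divide norm_power power_le_one)
    next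
      case 2
      then have "cmod (\<phi> z) ^ M \<le> cmod (\<phi> z0) ^ M" by (intro power_mono max) auto
      then show ?thesis using M unfolding norm_divide norm_power 2 by simp
    qed
  qed
  have "cmod (\<phi> z) ^ M \<le> cmod z" if "1/2 < cmod z" "cmod z < 1" for z
  proof -
    have "z \<in> S" "z \<noteq> 0" using that by (auto simp: S_def)
    then show ?thesis
      using \<open>\<And>z. z \<in> S \<Longrightarrow> cmod (\<phi> z ^ M / z) \<le> 1\<close>[of z]
      by (simp add: norm_divide norm_power divide_le_eq)
  qed
  then show ?thesis using M0 by blast
qed

text \<open>
  The derivative in the tangential direction \<open>\<i> \<xi>\<close> has real part 0 because \<open>Re \<phi>\<close> is maximal at \<open>\<xi>\<close>
  on the circle; by the Cauchy-Riemann equation this says that the radial derivative is real. It is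
  at least \<open>1 / N\<close> because \<open>|\<phi>|^N\<close> is at most the distance to the origin near \<open>\<xi>\<close>.
\<close>
lemma boundary_derivative_positive:
  fixes \<phi> :: "complex \<Rightarrow> complex" and D :: "complex \<Rightarrow> complex \<Rightarrow> complex"
  assumes hol: "\<phi> holomorphic_on ball 0 1"
    and der: "\<And>x. x \<in> cball 0 1 \<Longrightarrow> (\<phi> has_derivative D x) (at x within cball 0 1)"
    and cont: "\<And>v. continuous_on (cball 0 1) (\<lambda>x. D x v)"
    and le: "\<And>z. z \<in> cball 0 1 \<Longrightarrow> cmod (\<phi> z) \<le> 1"
    and less: "\<And>z. z \<in> ball 0 1 \<Longrightarrow> cmod (\<phi> z) < 1"
    and \<xi>: "cmod \<xi> = 1" and one: "\<phi> \<xi> = 1"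
  shows "\<exists>A>0. D \<xi> \<xi> = of_real A"
proof -
  have \<xi>c: "\<xi> \<in> cball 0 1" using \<xi> by simp
  have d\<xi>: "(\<phi> has_derivative D \<xi>) (at \<xi> within cball 0 1)" by (rule der[OF \<xi>c])
  have lin: "linear (D \<xi>)" using d\<xi> has_derivative_linear by blast
  have cphi: "continuous_on (cball 0 1) \<phi>"
    using der has_derivative_continuous continuous_on_eq_continuous_within by blast
  have "Re (D \<xi> (\<i> * \<xi>)) = 0"
  proof -
    have "((\<lambda>t. \<xi> * cis t) has_derivative (\<lambda>t. t *\<^sub>R (\<i> * \<xi>))) (at 0)"
      by (auto intro!: derivative_eq_intros simp: scaleR_conv_of_real algebra_simps)
    moreover have "(\<phi> has_derivative D \<xi>) (at (\<xi> * cis 0) within range (\<lambda>t. \<xi> * cis t))"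
    proof -
      have img: "range (\<lambda>t. \<xi> * cis t) \<subseteq> cball 0 1" using \<xi> by (auto simp: norm_mult)
      have "\<xi> * cis 0 = \<xi>" by simp
      then show ?thesis by (simp only:) (rule has_derivative_subset[OF d\<xi> img])
    qed
    ultimately have "((\<lambda>t. \<phi> (\<xi> * cis t)) has_derivative (\<lambda>t. D \<xi> (t *\<^sub>R (\<i> * \<xi>)))) (at 0)"
      by (rule has_derivative_in_compose)
    then have "((\<lambda>t. Re (\<phi> (\<xi> * cis t))) has_derivative (\<lambda>t. Re (D \<xi> (t *\<^sub>R (\<i> * \<xi>))))) (at 0)"
      by (rule has_derivative_Re)
    then have d: "DERIV (\<lambda>t. Re (\<phi> (\<xi> * cis t))) 0 :> Re (D \<xi> (\<i> * \<xi>))"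
      by (simp add: has_field_derivative_def linear_scale[OF lin] mult_commute_abs)
    have m: "Re (\<phi> (\<xi> * cis t)) \<le> Re (\<phi> (\<xi> * cis 0))" for t
      using order_trans[OF complex_Re_le_cmod le[of "\<xi> * cis t"]] \<xi> one by (simp add: norm_mult)
    show ?thesis by (rule DERIV_local_max[OF d zero_less_one]) (intro allI impI m)
  qed
  then have im: "Im (D \<xi> \<xi>) = 0"
    using cauchy_riemann_up_to_boundary[OF hol der cont \<xi>c, of \<xi>] by simp
  obtain N where N: "N > 0"
    and pow: "\<And>z. 1/2 < cmod z \<Longrightarrow> cmod z < 1 \<Longrightarrow> cmod (\<phi> z) ^ N \<le> cmod z"
    using power_le_norm_on_annulus[OF hol cphi le less] by blast
  let ?w = "\<lambda>t::real. \<phi> (\<xi> - of_real t * \<xi>)" and ?S = "{0..1::real}"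
  have mem: "\<xi> - of_real t * \<xi> \<in> cball 0 1" "cmod (\<xi> - of_real t * \<xi>) = 1 - t"
    if "t \<in> ?S" for t :: real
  proof -
    have "\<xi> - of_real t * \<xi> = of_real (1 - t) * \<xi>" by (simp add: algebra_simps)
    then show "cmod (\<xi> - of_real t * \<xi>) = 1 - t"
      using \<xi> that by (simp only: norm_mult norm_of_real) simp
    then show "\<xi> - of_real t * \<xi> \<in> cball 0 1" using that by simp
  qed
  have "((\<lambda>t::real. \<xi> - of_real t * \<xi>) has_derivative (\<lambda>t. t *\<^sub>R (- \<xi>))) (at 0 within ?S)"
    by (auto intro!: derivative_eq_intros simp: scaleR_conv_of_real)
  moreover have "(\<phi> has_derivative D \<xi>) (at (\<xi> - of_real 0 * \<xi>) within (\<lambda>t. \<xi> - of_real t * \<xi>) ` ?S)"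
  proof -
    have img: "(\<lambda>t. \<xi> - of_real t * \<xi>) ` ?S \<subseteq> cball 0 1" using mem(1) by blast
    have "\<xi> - of_real 0 * \<xi> = \<xi>" by simp
    then show ?thesis by (simp only:) (rule has_derivative_subset[OF d\<xi> img])
  qed
  ultimately have "(?w has_derivative (\<lambda>t. D \<xi> (t *\<^sub>R (- \<xi>)))) (at 0 within ?S)"
    by (rule has_derivative_in_compose)
  then have "(?w has_vector_derivative D \<xi> (- \<xi>)) (at 0 within ?S)"
    by (simp add: has_vector_derivative_def linear_scale[OF lin] linear_neg[OF lin])
  from tendsto_Re[OF has_vector_derivative_quotient[OF this]]
  have lim: "((\<lambda>t. Re ((?w t - ?w 0) / of_real t)) \<longlongrightarrow> - Re (D \<xi> \<xi>)) (at 0 within ?S)"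
    by (simp add: linear_neg[OF lin])
  have "- Re (D \<xi> \<xi>) \<le> - (1 / N)"
  proof (rule tendsto_upperbound[OF lim])
    have "Re ((?w t - ?w 0) / of_real t) \<le> - (1 / N)" if t: "0 < t" "t < 1/2" for t :: real
    proof -
      have tN: "t / N \<le> 1" using t N by (simp add: field_simps)
      have "cmod (\<xi> - of_real t * \<xi>) = 1 - t" using mem(2)[of t] t by auto
      then have "cmod (?w t) ^ N \<le> 1 - t" using pow[of "\<xi> - of_real t * \<xi>"] t by (simp only:)
      also have "1 - t \<le> (1 - t / N) ^ N"
        (* Bernoulli extracts the N-th root of the bound *)
        using Bernoulli_inequality[of "- (t / N)" N] tN t N by simp
      finally have "cmod (?w t) ^ Suc (N - 1) \<le> (1 - t / N) ^ Suc (N - 1)" using N by simp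
      then have "cmod (?w t) \<le> 1 - t / N" by (rule power_le_imp_le_base) (use tN in simp)
      then have "Re (?w t) - 1 \<le> - (1 / N) * t"
        using complex_Re_le_cmod[of "?w t"] by simp
      then have "(Re (?w t) - 1) / t \<le> - (1 / N)"
        using t by (simp only: pos_divide_le_eq)
      then show ?thesis by (simp add: one)
    qed
    then show "\<forall>\<^sub>F t in at 0 within ?S. Re ((?w t - ?w 0) / of_real t) \<le> - (1 / N)"
      by (auto simp: eventually_at intro!: exI[of _ "1/2"])
    show "at 0 within ?S \<noteq> bot" by (simp add: at_within_Icc_at_right)
  qed
  then have "Re (D \<xi> \<xi>) \<ge> 1 / N" by simp
  moreover have "1 / real N > 0" using N by simp
  ultimately have "Re (D \<xi> \<xi>) > 0" by linarith
  then show ?thesis using im by (intro exI[of _ "Re (D \<xi> \<xi>)"]) (simp add: complex_eq_iff)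
qed

lemma bounded_bilinear_cinner: "bounded_bilinear (cinner :: complex ^ 'd \<Rightarrow> complex ^ 'd \<Rightarrow> complex)"
proof
  show "\<exists>K. \<forall>a b :: complex ^ 'd. norm (cinner a b) \<le> norm a * norm b * K"
    by (intro exI[of _ 1] allI) (simp add: norm_cinner_le)
qed (simp_all add: cinner_def algebra_simps sum.distrib scaleR_sum_right)

lemma cinner_commute: "cinner w z = cnj (cinner z w)"
  by (simp add: cinner_def mult.commute)

text \<open>
  The one-variable lemma is applied to \<open>\<phi> z = \<langle>f z, f \<xi>\<rangle>\<close>, which is bounded by \<open>|f z|\<close> and has the
  value 1 at \<open>\<xi>\<close>.
\<close>
lemma disc_embedding_normal_derivative:
  fixes f :: "complex \<Rightarrow> complex ^ 'd"
  assumes f: "disc_embedding V f" and \<xi>: "cmod \<xi> = 1"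
  shows "\<exists>L A. A > 0 \<and> (f has_derivative L) (at \<xi> within cball 0 1) \<and> cinner (L \<xi>) (f \<xi>) = of_real A"
proof -
  obtain f' :: "complex \<Rightarrow> complex \<Rightarrow>\<^sub>L (complex ^ 'd)" and f''
    where f': "\<And>x. x \<in> cball 0 1 \<Longrightarrow> (f has_derivative f' x) (at x within cball 0 1)"
      and f'': "\<And>x. x \<in> cball 0 1 \<Longrightarrow> (f' has_derivative blinfun_apply (f'' x)) (at x within cball 0 1)"
    using f unfolding disc_embedding_def C2_on_def by blast
  have cf': "continuous_on (cball 0 1) f'"
    using f'' has_derivative_continuous continuous_on_eq_continuous_within by blast
  define p where "p = f \<xi>"
  have p: "norm p = 1" using f \<xi> by (simp add: disc_embedding_def p_def)
  have bl: "bounded_linear (\<lambda>v. cinner v p)"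
    by (rule bounded_bilinear.bounded_linear_left[OF bounded_bilinear_cinner])
  have nf: "cmod (cinner (f z) p) \<le> norm (f z)" for z using norm_cinner_le[of "f z" p] p by simp
  have "\<exists>A>0. cinner (f' \<xi> \<xi>) p = of_real A"
  proof (rule boundary_derivative_positive[where \<phi> = "\<lambda>z. cinner (f z) p" and D = "\<lambda>x v. cinner (f' x v) p"])
    show "(\<lambda>z. cinner (f z) p) holomorphic_on ball 0 1"
      using f unfolding cinner_def disc_embedding_def by (intro holomorphic_intros) auto
    show "((\<lambda>z. cinner (f z) p) has_derivative (\<lambda>v. cinner (f' x v) p)) (at x within cball 0 1)"
      if "x \<in> cball 0 1" for x
      by (rule bounded_linear.has_derivative[OF bl f'[OF that]])
    show "continuous_on (cball 0 1) (\<lambda>x. cinner (f' x v) p)" for v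
      by (intro bounded_linear.continuous_on[OF bl] continuous_intros cf')
    show "cmod (cinner (f z) p) < 1" if "z \<in> ball 0 1" for z
      using f that nf[of z] unfolding disc_embedding_def by fastforce
    show "cmod (cinner (f z) p) \<le> 1" if "z \<in> cball 0 1" for z
    proof (cases "z \<in> ball 0 1")
      case True
      then show ?thesis using f nf[of z] unfolding disc_embedding_def by fastforce
    next
      case False
      then have "cmod z = 1" using that by simp
      then have "norm (f z) = 1" using f that unfolding disc_embedding_def by blast
      then show ?thesis using nf[of z] by simp
    qed
    show "cinner (f \<xi>) p = 1" using p by (simp add: p_def cinner_self)
  qed (use \<xi> in auto)
  then show ?thesis using f'[of \<xi>] \<xi> unfolding p_def by auto
qed

lemma kernel_quotient_limit:
  fixes F G :: "real \<Rightarrow> complex ^ 'd"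
  assumes F: "(F has_vector_derivative F') (at 0 within S)" and G: "(G has_vector_derivative G') (at 0 within S)"
    and p: "F 0 = p" "G 0 = p" "norm p = 1"
    and F': "cinner F' p = -1" and G': "cinner G' p = -1"
  shows "((\<lambda>t. (1 - cinner (F t) (G t)) / of_real t) \<longlongrightarrow> 2) (at 0 within S)"
proof -
  have "((\<lambda>t. cinner (F t) (G t)) has_vector_derivative cinner (F 0) G' + cinner F' (G 0)) (at 0 within S)"
    by (rule bounded_bilinear.has_vector_derivative[OF bounded_bilinear_cinner F G])
  moreover have "cinner p G' = -1" using G' by (subst cinner_commute) simp
  ultimately have "((\<lambda>t. cinner (F t) (G t)) has_vector_derivative -2) (at 0 within S)"
    using F' p by simp
  from tendsto_minus[OF has_vector_derivative_quotient[OF this]]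
  show ?thesis using p by (simp add: cinner_self minus_divide_left)
qed

text \<open>
  The normalization of the normal components of \<open>F'\<close> and \<open>G'\<close> to \<open>-1\<close> makes numerator and denominator
  agree to leading order: each of the three kernel denominators is \<open>2 t + o(t)\<close>.
\<close>
lemma kernel_ratio_limit:
  fixes F G :: "real \<Rightarrow> complex ^ 'd"
  assumes F: "(F has_vector_derivative F') (at 0 within S)" and G: "(G has_vector_derivative G') (at 0 within S)"
    and p: "F 0 = p" "G 0 = p" "norm p = 1"
    and F': "cinner F' p = -1" and G': "cinner G' p = -1"
  shows "((\<lambda>t. (cmod (1 - cinner (F t) (G t)))\<^sup>2
      / (cmod (1 - cinner (F t) (F t)) * cmod (1 - cinner (G t) (G t)))) \<longlongrightarrow> 1) (at 0 within S)"
proof (rule Lim_transform_eventually)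
  let ?q = "\<lambda>F G t. cmod ((1 - cinner (F t) (G t)) / of_real t)"
  have "((\<lambda>t. (?q F G t)\<^sup>2 / (?q F F t * ?q G G t)) \<longlongrightarrow> (cmod 2)\<^sup>2 / (cmod 2 * cmod 2)) (at 0 within S)"
    by (intro tendsto_intros kernel_quotient_limit[OF F G p F' G']
        kernel_quotient_limit[OF F F p(1,1,3) F' F'] kernel_quotient_limit[OF G G p(2,2,3) G' G']) auto
  then show "((\<lambda>t. (?q F G t)\<^sup>2 / (?q F F t * ?q G G t)) \<longlongrightarrow> 1) (at 0 within S)" by simp
  have "(?q F G t)\<^sup>2 / (?q F F t * ?q G G t) = (cmod (1 - cinner (F t) (G t)))\<^sup>2
      / (cmod (1 - cinner (F t) (F t)) * cmod (1 - cinner (G t) (G t)))" if "t \<noteq> 0" for t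
    using that by (simp add: norm_divide power2_eq_square)
  then show "\<forall>\<^sub>F t in at 0 within S. (?q F G t)\<^sup>2 / (?q F F t * ?q G G t)
      = (cmod (1 - cinner (F t) (G t)))\<^sup>2
      / (cmod (1 - cinner (F t) (F t)) * cmod (1 - cinner (G t) (G t)))"
    by (auto simp: eventually_at intro!: exI[of _ 1])
qed

lemma radial_path_derivative:
  fixes f :: "complex \<Rightarrow> 'b::real_normed_vector"
  assumes L: "(f has_derivative L) (at \<xi> within cball 0 1)" and \<xi>: "cmod \<xi> = 1"
    and A: "A > 0" and S: "S \<subseteq> {0..A}"
  shows "((\<lambda>t. f (\<xi> - of_real (t / A) * \<xi>)) has_vector_derivative - (1 / A) *\<^sub>R L \<xi>) (at 0 within S)"
proof -
  have lin: "linear L" using L has_derivative_linear by blast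
  have "((\<lambda>t::real. \<xi> - of_real (t / A) * \<xi>) has_derivative (\<lambda>t. (t * (- 1 / A)) *\<^sub>R \<xi>)) (at 0 within S)"
    using A by (auto intro!: derivative_eq_intros simp: scaleR_conv_of_real)
  moreover have "(f has_derivative L) (at (\<xi> - of_real (0 / A) * \<xi>) within (\<lambda>t. \<xi> - of_real (t / A) * \<xi>) ` S)"
  proof -
    have "cmod (\<xi> - of_real (t / A) * \<xi>) \<le> 1" if "t \<in> S" for t
    proof -
      have "\<xi> - of_real (t / A) * \<xi> = of_real (1 - t / A) * \<xi>" by (simp add: algebra_simps)
      moreover have "\<bar>1 - t / A\<bar> \<le> 1" using that S A by (auto simp: field_simps abs_le_iff)
      ultimately show ?thesis using \<xi> by (simp only: norm_mult norm_of_real) simp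
    qed
    then have img: "(\<lambda>t. \<xi> - of_real (t / A) * \<xi>) ` S \<subseteq> cball 0 1"
      unfolding image_subset_iff mem_cball_0 by blast
    have "\<xi> - of_real (0 / A) * \<xi> = \<xi>" by simp
    then show ?thesis by (simp only:) (rule has_derivative_subset[OF L img])
  qed
  ultimately have "((\<lambda>t. f (\<xi> - of_real (t / A) * \<xi>)) has_derivative (\<lambda>t. L ((t * (- 1 / A)) *\<^sub>R \<xi>))) (at 0 within S)"
    by (rule has_derivative_in_compose)
  then show ?thesis
    by (simp add: has_vector_derivative_def linear_scale[OF lin] linear_neg[OF lin])
qed

section \<open>Boundary identifications are determined by the multiplier algebra\<close>

text \<open>
  This is the only place where the two multiplier algebras are compared: a coordinate function of the
  ball restricts to a multiplier on \<open>W\<close>, and its pullback by \<open>g\<close> is \<open>g $ j\<close>.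
\<close>
lemma coordinate_factors_through:
  fixes f :: "complex \<Rightarrow> complex ^ 'm" and g :: "complex \<Rightarrow> complex ^ 'n"
  assumes f: "disc_embedding V f" and g: "disc_embedding W g" and sub: "disc_mult W g \<subseteq> disc_mult V f"
  shows "\<exists>\<Phi>\<in>DA_mult. \<forall>z\<in>ball 0 1. \<Phi> (f z) = g z $ j"
proof -
  let ?\<phi> = "zero_ext (ball 0 1) (\<lambda>z. g z $ j)"
  have inj: "inj_on f (ball 0 1)" "inj_on g (ball 0 1)"
    and V: "V = f ` ball 0 1" and W: "W = g ` ball 0 1" and Wb: "W \<subseteq> ball 0 1"
    using f g by (auto simp: disc_embedding_def)
  have "zero_ext W (?\<phi> \<circ> the_inv_into (ball 0 1) g) = zero_ext W (zero_ext (ball 0 1) (\<lambda>w. w $ j))"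
    using Wb the_inv_into_into[OF inj(2) _ order_refl] f_the_inv_into_f[OF inj(2)]
    by (auto simp: zero_ext_def W fun_eq_iff)
  then have "zero_ext W (?\<phi> \<circ> the_inv_into (ball 0 1) g) \<in> variety_mult W"
    using coordinate_multiplier[of j] by (auto simp: variety_mult_def)
  then have "?\<phi> \<in> disc_mult W g" by (simp add: disc_mult_def fun_on_def zero_ext_def)
  then have "?\<phi> \<in> disc_mult V f" using sub by blast
  then obtain \<Phi> where \<Phi>: "\<Phi> \<in> DA_mult"
    and eq: "zero_ext V (?\<phi> \<circ> the_inv_into (ball 0 1) f) = zero_ext V \<Phi>"
    by (auto simp: disc_mult_def variety_mult_def)
  have "\<Phi> (f z) = g z $ j" if z: "z \<in> ball 0 1" for z
    using fun_cong[OF eq, of "f z"] z the_inv_into_f_f[OF inj(1) z] by (simp add: V zero_ext_def)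
  then show ?thesis using \<Phi> by blast
qed

lemma boundary_identification_transfers:
  fixes f :: "complex \<Rightarrow> complex ^ 'm" and g :: "complex \<Rightarrow> complex ^ 'n"
  assumes f: "disc_embedding V f" and g: "disc_embedding W g"
    and sub: "disc_mult W g \<subseteq> disc_mult V f"
    and \<xi>: "cmod \<xi> = 1" and \<zeta>: "cmod \<zeta> = 1" and eq: "f \<xi> = f \<zeta>"
  shows "g \<xi> = g \<zeta>"
proof -
  obtain L A where A: "A > 0" and L: "(f has_derivative L) (at \<xi> within cball 0 1)"
    and LA: "cinner (L \<xi>) (f \<xi>) = of_real A"
    using disc_embedding_normal_derivative[OF f \<xi>] by blast
  obtain M B where B: "B > 0" and M: "(f has_derivative M) (at \<zeta> within cball 0 1)"
    and MB: "cinner (M \<zeta>) (f \<zeta>) = of_real B"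
    using disc_embedding_normal_derivative[OF f \<zeta>] by blast
  (* for t in S - {0} both radial points below lie in the open disc *)
  define S where "S = {0..min A B}"
  define z where "z t = \<xi> - of_real (t / A) * \<xi>" for t
  define w where "w t = \<zeta> - of_real (t / B) * \<zeta>" for t
  have bot: "at 0 within S \<noteq> bot" using A B by (simp add: S_def at_within_Icc_at_right)
  have inball: "\<eta> - of_real (t / c) * \<eta> \<in> ball 0 1"
    if "cmod \<eta> = 1" "0 < t" "t \<le> c" for \<eta> :: complex and t c :: real
  proof -
    have "\<eta> - of_real (t / c) * \<eta> = of_real (1 - t / c) * \<eta>" by (simp add: algebra_simps)
    moreover have "\<bar>1 - t / c\<bar> < 1" using that by (auto simp: field_simps abs_less_iff)
    ultimately show ?thesis using that by (simp only: mem_ball_0 norm_mult norm_of_real) simp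
  qed
  have p: "norm (f \<xi>) = 1" using f \<xi> by (simp add: disc_embedding_def)
  have scale: "cinner (c *\<^sub>R u) v = of_real c * cinner u v" for c and u v :: "complex ^ 'm"
    by (simp add: bounded_bilinear.scaleR_left[OF bounded_bilinear_cinner] scaleR_conv_of_real[of c "cinner u v"])
  have F: "((\<lambda>t. f (z t)) has_vector_derivative - (1 / A) *\<^sub>R L \<xi>) (at 0 within S)"
    unfolding z_def by (rule radial_path_derivative[OF L \<xi> A]) (simp add: S_def)
  have G: "((\<lambda>t. f (w t)) has_vector_derivative - (1 / B) *\<^sub>R M \<zeta>) (at 0 within S)"
    unfolding w_def by (rule radial_path_derivative[OF M \<zeta> B]) (simp add: S_def)
  have ratio: "((\<lambda>t. (cmod (1 - cinner (f (z t)) (f (w t))))\<^sup>2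
      / (cmod (1 - cinner (f (z t)) (f (z t))) * cmod (1 - cinner (f (w t)) (f (w t))))) \<longlongrightarrow> 1) (at 0 within S)"
  proof (rule kernel_ratio_limit[OF F G])
    show "f (z 0) = f \<xi>" "f (w 0) = f \<xi>" by (simp_all add: z_def w_def eq)
    show "cinner (- (1 / A) *\<^sub>R L \<xi>) (f \<xi>) = -1" using LA A by (simp only: scale) simp
    show "cinner (- (1 / B) *\<^sub>R M \<zeta>) (f \<xi>) = -1" using MB B by (simp only: scale eq) simp
  qed (rule p)
  have cg: "continuous_on (cball 0 1) g"
    using g has_derivative_continuous
    unfolding disc_embedding_def C2_on_def continuous_on_eq_continuous_within by blast
  have "g \<xi> $ j = g \<zeta> $ j" for j
  proof -
    obtain \<Phi> where "\<Phi> \<in> DA_mult" and \<Phi>: "\<And>z. z \<in> ball 0 1 \<Longrightarrow> \<Phi> (f z) = g z $ j"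
      using coordinate_factors_through[OF f g sub] by blast
    then obtain C where C: "\<And>u v. u \<in> ball 0 1 \<Longrightarrow> v \<in> ball 0 1 \<Longrightarrow> (cmod (\<Phi> u - \<Phi> v))\<^sup>2
        \<le> C * ((cmod (1 - cinner u v))\<^sup>2 / (cmod (1 - cinner u u) * cmod (1 - cinner v v)) - 1)"
      using DA_mult_oscillation by blast
    let ?d = "\<lambda>t. (cmod (g (z t) $ j - g (w t) $ j))\<^sup>2"
    have radial: "((\<lambda>t. g (\<eta> - of_real (t / c) * \<eta>) $ j) \<longlongrightarrow> g \<eta> $ j) (at 0 within S)"
      if "cmod \<eta> = 1" "S \<subseteq> {0..c}" "c > 0" for \<eta> c
    proof -
      have "\<forall>\<^sub>F t in at 0 within S. \<eta> - of_real (t / c) * \<eta> \<in> cball 0 1"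
      proof -
        have "\<eta> - of_real (t / c) * \<eta> \<in> cball 0 1" if "t \<in> S" "t \<noteq> 0" for t
        proof -
          have "0 < t" "t \<le> c" using that \<open>S \<subseteq> {0..c}\<close> by (auto simp: S_def)
          then show ?thesis using inball[OF \<open>cmod \<eta> = 1\<close>] ball_subset_cball by blast
        qed
        then show ?thesis unfolding eventually_at by (intro exI[of _ 1] conjI ballI impI zero_less_one) blast
      qed
      moreover have "((\<lambda>t. \<eta> - of_real (t / c) * \<eta>) \<longlongrightarrow> \<eta> - of_real (0 / c) * \<eta>) (at 0 within S)"
        using that by (intro tendsto_intros) auto
      ultimately have "((\<lambda>t. g (\<eta> - of_real (t / c) * \<eta>)) \<longlongrightarrow> g \<eta>) (at 0 within S)"
        using that by (intro continuous_on_tendsto_compose[OF cg]) auto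
      then show ?thesis by (rule tendsto_vec_nth)
    qed
    have 1: "(?d \<longlongrightarrow> (cmod (g \<xi> $ j - g \<zeta> $ j))\<^sup>2) (at 0 within S)"
      unfolding z_def w_def using \<xi> \<zeta> A B by (intro tendsto_intros radial) (auto simp: S_def)
    have 2: "((\<lambda>t. C * ((cmod (1 - cinner (f (z t)) (f (w t))))\<^sup>2
        / (cmod (1 - cinner (f (z t)) (f (z t))) * cmod (1 - cinner (f (w t)) (f (w t)))) - 1))
        \<longlongrightarrow> C * (1 - 1)) (at 0 within S)"
      by (intro tendsto_intros ratio)
    have "?d t \<le> C * ((cmod (1 - cinner (f (z t)) (f (w t))))\<^sup>2
        / (cmod (1 - cinner (f (z t)) (f (z t))) * cmod (1 - cinner (f (w t)) (f (w t)))) - 1)"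
      if "t \<in> S" "t \<noteq> 0" for t
    proof -
      have zw: "z t \<in> ball 0 1" "w t \<in> ball 0 1"
      proof -
        have "0 < t" "t \<le> A" "t \<le> B" using that by (auto simp: S_def)
        then show "z t \<in> ball 0 1" "w t \<in> ball 0 1"
          using inball[OF \<xi>] inball[OF \<zeta>] unfolding z_def w_def by blast+
      qed
      then have "f (z t) \<in> ball 0 1" "f (w t) \<in> ball 0 1" using f zw unfolding disc_embedding_def by blast+
      then show ?thesis using C \<Phi> zw by metis
    qed
    then have "(cmod (g \<xi> $ j - g \<zeta> $ j))\<^sup>2 \<le> C * (1 - 1)"
      by (intro tendsto_le[OF bot 2 1]) (auto simp: eventually_at intro!: exI[of _ 1])
    then show ?thesis by simp
  qed
  then show ?thesis by (simp add: vec_eq_iff)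
qed

theorem theorem1:
  fixes V :: "(complex ^ 'm) set" and W :: "(complex ^ 'n) set"
    and f :: "complex \<Rightarrow> complex ^ 'm" and g :: "complex \<Rightarrow> complex ^ 'n"
  assumes "attached_analytic_disc V" and "attached_analytic_disc W"
    and "disc_embedding V f" and "disc_embedding W g"
    and "disc_mult V f = disc_mult W g"
  shows "\<forall>\<xi> \<in> sphere 0 1. \<forall>\<zeta> \<in> sphere 0 1. f \<xi> = f \<zeta> \<longleftrightarrow> g \<xi> = g \<zeta>"
proof (intro ballI iffI)
  fix \<xi> \<zeta> :: complex assume "\<xi> \<in> sphere 0 1" "\<zeta> \<in> sphere 0 1"
  then have n: "cmod \<xi> = 1" "cmod \<zeta> = 1" by simp_all
  show "g \<xi> = g \<zeta>" if "f \<xi> = f \<zeta>"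
    by (rule boundary_identification_transfers[OF assms(3,4) _ n that]) (simp add: assms(5))
  show "f \<xi> = f \<zeta>" if "g \<xi> = g \<zeta>"
    by (rule boundary_identification_transfers[OF assms(4,3) _ n that]) (simp add: assms(5))
qed

end
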